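(* Let $\mathfrak a=((\lambda_j,\alpha_j))_{j\in\mathbb Z}$ be a sequence in which $(\lambda_j)$ is a strictly increasing real sequence with $\lambda_0\le0<\lambda_1$ and each $\alpha_j$ is a non-zero matrix in $M_r^+$, and suppose $\mathfrak a$ satisfies condition (A1). Set $\mu:=\mu^{\mathfrak a}$. Then the limit $$H_\mu(x)=\lim_{n\to\infty}\int_{(-\pi(n-\frac12),\,\pi(n+\frac12)]}e^{2i\lambda x}\,d(\mu-\mu_0)(\lambda)$$ exists in the topology of $L_2((-1,1),M_r)$. If, in addition, $\mathfrak a$ satisfies condition (A3), then $H_\mu$ is an accelerant and belongs to $\mathfrak H_2^s$.
   Context: $M_r$ is the algebra of complex $r\times r$ matrices with operator norm, $I$ its identity, $M_r^+=\{A\in M_r: A=A^*\ge0\}$. $\Delta_n:=(\pi n-\frac\pi2,\pi n+\frac\pi2]$, $n\in\mathbb Z$. Condition (A1): $\sup_{n\in\mathbb Z}\sum_{\lambda_j\in\Delta_n}1<\infty$, $\sum_{n\in\mathbb Z}\sum_{\lambda_j\in\Delta_n}|\lambda_j-\pi n|^2<\infty$, and $\sum_{n\in\mathbb Z}\|I-\sum_{\lambda_k\in\Delta_n}\alpha_k\|^2<\infty$. Condition (A3): the system $\{d\,e^{i\lambda_jt}\mid j\in\mathbb Z,\ d\in\operatorname{Ran}\alpha_j\}$ is complete in $L_2((-1,1),\mathbb C^r)$. $\mu^{\mathfrak a}:=\sum_{j\in\mathbb Z}\alpha_j\delta_{\lambda_j}$ and $\mu_0:=\sum_{n\in\mathbb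 Z}I\delta_{\pi n}$, where $\delta_\lambda$ is the Dirac measure at $\lambda$. A function $H\in L_2((-1,1),M_r)$ is an accelerant if for every $a\in[0,1]$ the equation $f(x)+\int_0^aH(x-t)f(t)\,dt=0$ has only the trivial solution in $L_2((0,1),\mathbb C^r)$; $\mathfrak H_2$ is the set of accelerants, and $\mathfrak H_2^s:=\{H\in\mathfrak H_2\mid H(x)^*=H(-x)\text{ for a.e. }x\in(-1,1)\}$. *)

theory Defs
  imports "HOL-Analysis.Analysis"
begin

definition mnorm :: "complex^'r^'r \<Rightarrow> real" where
  "mnorm A = onorm (\<lambda>v::complex^'r. A *v v)"

definition cadj :: "complex^'r^'r \<Rightarrow> complex^'r^'r" where
  "cadj A = (\<chi> i j. cnj (A $ j $ i))"

definition mscale :: "complex \<Rightarrow> complex^'r^'r \<Rightarrow> complex^'r^'r" where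
  "mscale c A = (\<chi> i j. c * A $ i $ j)"

definition mpos :: "complex^'r^'r \<Rightarrow> bool" where
  "mpos A \<longleftrightarrow> cadj A = A \<and>
     (\<forall>v::complex^'r. 0 \<le> Re (\<Sum>i\<in>UNIV. cnj (v $ i) * (A *v v) $ i))"

definition Delta :: "int \<Rightarrow> real set" where
  "Delta n = {pi * n - pi/2 <.. pi * n + pi/2}"

definition condA1 :: "(int \<Rightarrow> real) \<Rightarrow> (int \<Rightarrow> complex^'r^'r) \<Rightarrow> bool" where
  "condA1 lam alpha \<longleftrightarrow>
     (\<forall>n. finite {j. lam j \<in> Delta n}) \<and>
     (\<exists>C::nat. \<forall>n. card {j. lam j \<in> Delta n} \<le> C) \<and>
     (\<lambda>n. \<Sum>j\<in>{j. lam j \<in> Delta n}. (lam j - pi * n)^2) summable_on (UNIV :: int set) \<and>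
     (\<lambda>n. (mnorm (mat 1 - (\<Sum>k\<in>{k. lam k \<in> Delta n}. alpha k)))^2) summable_on (UNIV :: int set)"

definition sq_int :: "real set \<Rightarrow> ('a::euclidean_space \<Rightarrow> real) \<Rightarrow> (real \<Rightarrow> 'a) \<Rightarrow> bool" where
  "sq_int S N f \<longleftrightarrow> set_borel_measurable lebesgue S f \<and>
     (\<integral>\<^sup>+x\<in>S. ennreal ((N (f x))^2) \<partial>lebesgue) < \<infinity>"

definition L2_tendsto :: "real set \<Rightarrow> ('a::euclidean_space \<Rightarrow> real) \<Rightarrow> (nat \<Rightarrow> real \<Rightarrow> 'a) \<Rightarrow> (real \<Rightarrow> 'a) \<Rightarrow> bool" where
  "L2_tendsto S N F H \<longleftrightarrow> sq_int S N H \<and>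
     (\<lambda>n. \<integral>\<^sup>+x\<in>S. ennreal ((N (F n x - H x))^2) \<partial>lebesgue) \<longlonglongrightarrow> 0"

text \<open>The integral of e^{2i\<lambda>x} against \<mu>^a - \<mu>_0 over (-\<pi>(n-1/2), \<pi>(n+1/2)], both measures
  being discrete (finite sums of point masses inside the bounded interval).\<close>
definition Hpart :: "(int \<Rightarrow> real) \<Rightarrow> (int \<Rightarrow> complex^'r^'r) \<Rightarrow> nat \<Rightarrow> real \<Rightarrow> complex^'r^'r" where
  "Hpart lam alpha n x =
     (let J = {- pi * (real n - 1/2) <.. pi * (real n + 1/2)} in
       (\<Sum>j\<in>{j. lam j \<in> J}. mscale (exp (2 * \<i> * complex_of_real (lam j * x))) (alpha j))
       - mscale (\<Sum>k\<in>{k::int. pi * k \<in> J}. exp (2 * \<i> * complex_of_real (pi * k * x))) (mat 1))"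

definition condA3 :: "(int \<Rightarrow> real) \<Rightarrow> (int \<Rightarrow> complex^'r^'r) \<Rightarrow> bool" where
  "condA3 lam alpha \<longleftrightarrow>
     (\<forall>g::real \<Rightarrow> complex^'r. sq_int {-1<..<1} norm g \<longrightarrow>
       (\<forall>\<epsilon>>0. \<exists>F::(int \<times> (complex^'r)) set. \<exists>c::int \<times> (complex^'r) \<Rightarrow> complex.
          finite F \<and> (\<forall>(j,d)\<in>F. d \<in> range (\<lambda>v. alpha j *v v)) \<and>
          (\<integral>\<^sup>+t\<in>{-1<..<1}. ennreal ((norm (g t -
              (\<Sum>(j,d)\<in>F. (c (j,d) * exp (\<i> * complex_of_real (lam j * t))) *s d)))^2) \<partial>lebesgue)
            < ennreal \<epsilon>))"

definition accelerant :: "(real \<Rightarrow> complex^'r^'r) \<Rightarrow> bool" where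
  "accelerant H \<longleftrightarrow> sq_int {-1<..<1} mnorm H \<and>
     (\<forall>a\<in>{0..1}. \<forall>f::real \<Rightarrow> complex^'r.
        sq_int {0<..<1} norm f \<and>
        (AE x in lebesgue. x \<in> {0<..<1} \<longrightarrow> f x + (\<integral>t\<in>{0..a}. H (x - t) *v f t \<partial>lebesgue) = 0)
        \<longrightarrow> (AE x in lebesgue. x \<in> {0<..<1} \<longrightarrow> f x = 0))"

definition accelerant_s :: "(real \<Rightarrow> complex^'r^'r) \<Rightarrow> bool" where
  "accelerant_s H \<longleftrightarrow> accelerant H \<and>
     (AE x in lebesgue. x \<in> {-1<..<1} \<longrightarrow> cadj (H x) = H (- x))"

end

(* Group the nodes and the points pi k into the blocks Delta_k. Each block equals e^{2 pi i k x} times a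
   smooth factor whose value at 0 and derivative are controlled by the square summable quantities of (A1),
   so the partial sums are Cauchy in L_2.

   Suppose f solves the accelerant equation and let u be its restriction to (0,a), with Fourier transform U.
   Pairing the equation with u and replacing H by the partial sums gives in the limit
   |u|^2 + sum_j <alpha_j U(lambda_j), U(lambda_j)> - sum_k |U(pi k)|^2 = 0.
   Bessel's inequality for (e^{2 pi i k x}) on (0,1) forces the nonnegative terms of the first sum to vanish.
   Hence alpha_j U(lambda_j) = 0 for every j: u, rescaled to (-1,1), is orthogonal to the system that (A3)
   declares complete, so u = 0 and then f = 0. *)

theory Submission
  imports Defs
begin

section \<open>Trigonometric sums\<close>

text \<open>(A1) controls the block sums of the \<open>alpha j\<close>, never a single one.
  Positivity supplies the missing uniform bound: nonnegative diagonal entries are dominated by their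
  sum over a block, and off-diagonal entries by diagonal ones. The nodes are in general not
  multiples of pi, so distinct blocks are not orthogonal. Writing each smooth factor as its value at
  0 plus the integral of its derivative makes Parseval's identity applicable all the same, at the
  price of constants. For H only L_2 convergence is available, so no series is paired with u term by
  term. The pairing is done for each finite window: convolution with u turns L_2 convergence of the
  kernels into convergence that is uniform in x, and the accelerant equation becomes an inequality
  with error \<open>e * L\<close>, where L is the L_1 norm of u. The atoms of mu_0 sit at exactly
  the frequencies of the orthonormal basis of L_2(0,1), and their weights are I; their negative
  contribution is therefore a Bessel sum, which |u|^2 absorbs at every finite stage.\<close>

lemma continuous_cis: "continuous_on S h \<Longrightarrow> continuous_on S (\<lambda>x. cis (h x))"
  for h :: "'b::topological_space \<Rightarrow> real"
  unfolding cis_conv_exp by (intro continuous_intros)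

text \<open>For nonzero n the antiderivative takes the same value at all integers. Integer endpoints
  cover both intervals needed later: \<open>{-1..1}\<close> for the kernels and
  \<open>{0..1}\<close> for Bessel's inequality.\<close>

lemma has_integral_cis_int:
  fixes a b n :: int
  assumes "a \<le> b"
  shows "((\<lambda>x. cis (2 * pi * real_of_int n * x)) has_integral (if n = 0 then of_int (b - a) else 0))
    {real_of_int a..real_of_int b}"
proof (cases "n = 0")
  case True
  then show ?thesis
    using has_integral_const_real[of "1::complex" "real_of_int a" "real_of_int b"] assms
    by (simp add: scaleR_conv_of_real)
next
  case False
  define c where "c = 2 * pi * real_of_int n"
  have c: "c \<noteq> 0" using False by (simp add: c_def)
  define G where "G = (\<lambda>x. exp (\<i> * of_real c * of_real x) / (\<i> * of_real c))"
  have "((\<lambda>x. cis (c * x)) has_integral (G (of_int b) - G (of_int a))) {real_of_int a..real_of_int b}"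
  proof (rule fundamental_theorem_of_calculus)
    fix x assume "x \<in> {real_of_int a..real_of_int b}"
    have "((\<lambda>z. exp (\<i> * of_real c * z) / (\<i> * of_real c)) has_field_derivative cis (c * x)) (at (of_real x))"
      using c by (auto intro!: derivative_eq_intros simp: cis_conv_exp mult_ac)
    then show "(G has_vector_derivative cis (c * x)) (at x within {real_of_int a..real_of_int b})"
      unfolding G_def by (rule has_vector_derivative_real_field)
  qed (use assms in simp)
  moreover have "exp (\<i> * of_real c * of_real (of_int m)) = 1" for m :: int
  proof -
    have "exp (\<i> * of_real c * of_real (of_int m)) = cis (2 * pi * of_int (n * m))"
      by (simp add: cis_conv_exp c_def mult_ac)
    also have "\<dots> = 1" by (rule cis_multiple_2pi) simp
    finally show ?thesis .
  qed
  ultimately show ?thesis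
    using False unfolding G_def by (simp add: c_def)
qed

text \<open>Parseval over b - a full periods: once the square is expanded, only the diagonal terms
  survive integration.\<close>

lemma has_integral_norm_sq_trig_poly:
  fixes a b :: int and c :: "int \<Rightarrow> complex"
  assumes "a \<le> b" "finite K"
  shows "((\<lambda>x. (norm (\<Sum>k\<in>K. c k * cis (2 * pi * real_of_int k * x)))\<^sup>2) has_integral
    of_int (b - a) * (\<Sum>k\<in>K. (norm (c k))\<^sup>2)) {real_of_int a..real_of_int b}"
proof -
  let ?e = "\<lambda>k x. cis (2 * pi * real_of_int k * x)"
  have "((\<lambda>x. \<Sum>k\<in>K. \<Sum>l\<in>K. c k * cnj (c l) * ?e (k - l) x) has_integral
     (\<Sum>k\<in>K. \<Sum>l\<in>K. c k * cnj (c l) * (if k - l = 0 then of_int (b - a) else 0)))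
     {real_of_int a..real_of_int b}"
    by (intro has_integral_sum has_integral_mult_right has_integral_cis_int assms)
  also have "(\<lambda>x. \<Sum>k\<in>K. \<Sum>l\<in>K. c k * cnj (c l) * ?e (k - l) x) =
     (\<lambda>x. of_real ((norm (\<Sum>k\<in>K. c k * ?e k x))\<^sup>2))"
  proof
    fix x
    have "c k * cnj (c l) * ?e (k - l) x = (c k * ?e k x) * cnj (c l * ?e l x)" for k l
    proof -
      have "?e (k - l) x = ?e k x * cnj (?e l x)"
        by (simp add: cis_cnj cis_mult algebra_simps)
      then show ?thesis by simp
    qed
    then show "(\<Sum>k\<in>K. \<Sum>l\<in>K. c k * cnj (c l) * ?e (k - l) x) =
       of_real ((norm (\<Sum>k\<in>K. c k * ?e k x))\<^sup>2)"
      by (simp only: complex_norm_square cnj_sum sum_product)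
  qed
  also have "(\<Sum>k\<in>K. \<Sum>l\<in>K. c k * cnj (c l) * (if k - l = 0 then of_int (b - a) else 0)) =
     (\<Sum>k\<in>K. of_real (of_int (b - a) * (norm (c k))\<^sup>2))"
  proof (rule sum.cong[OF refl])
    fix k assume "k \<in> K"
    have "(\<Sum>l\<in>K. c k * cnj (c l) * (if k - l = 0 then of_int (b - a) else 0)) =
       (\<Sum>l\<in>K. if k = l then c k * cnj (c l) * of_int (b - a) else 0)"
      by (rule sum.cong) auto
    also have "\<dots> = c k * cnj (c k) * of_int (b - a)"
      using \<open>k \<in> K\<close> assms(2) by simp
    also have "\<dots> = of_real (of_int (b - a) * (norm (c k))\<^sup>2)"
      unfolding complex_norm_square[symmetric] by simp
    finally show "(\<Sum>l\<in>K. c k * cnj (c l) * (if k - l = 0 then of_int (b - a) else 0)) =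
       of_real (of_int (b - a) * (norm (c k))\<^sup>2)" .
  qed
  finally have "((\<lambda>x. complex_of_real ((norm (\<Sum>k\<in>K. c k * ?e k x))\<^sup>2)) has_integral
      of_real (\<Sum>k\<in>K. of_int (b - a) * (norm (c k))\<^sup>2)) {real_of_int a..real_of_int b}"
    by simp
  from has_integral_linear[OF this bounded_linear_Re] show ?thesis
    by (simp add: o_def sum_distrib_left)
qed

lemma norm_add_sq_le: "(norm (x + y))\<^sup>2 \<le> 2 * (norm x)\<^sup>2 + 2 * (norm y)\<^sup>2"
  for x y :: "'a::real_normed_vector"
proof -
  have "(norm (x + y))\<^sup>2 \<le> (norm x + norm y)\<^sup>2"
    by (intro power_mono norm_triangle_ineq) simp
  also have "\<dots> \<le> 2 * (norm x)\<^sup>2 + 2 * (norm y)\<^sup>2"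
    using sum_squares_bound[of "norm x" "norm y"] by (simp add: power2_sum)
  finally show ?thesis .
qed

text \<open>Cauchy-Schwarz against the constant 1. With I the norm of the integral, integrating 2 I
  |f| \<le> I^2 + |f|^2 gives 2 I^2 \<le> I^2 (b - a) + \<integral> |f|^2, and length at most 1 lets
  one I^2 be absorbed.\<close>

lemma norm_integral_sq_le:
  fixes f :: "real \<Rightarrow> 'a::euclidean_space"
  assumes "continuous_on {a..b} f" "0 \<le> b - a" "b - a \<le> 1"
  shows "(norm (integral {a..b} f))\<^sup>2 \<le> integral {a..b} (\<lambda>s. (norm (f s))\<^sup>2)"
proof -
  define I where "I = norm (integral {a..b} f)"
  have int: "f integrable_on {a..b}" "(\<lambda>s. norm (f s)) integrable_on {a..b}"
    "(\<lambda>s. (norm (f s))\<^sup>2) integrable_on {a..b}"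
    by (intro integrable_continuous_interval continuous_intros assms)+
  have I: "I \<le> integral {a..b} (\<lambda>s. norm (f s))" "I \<ge> 0"
    unfolding I_def by (auto intro!: integral_norm_bound_integral int)
  have "2 * I\<^sup>2 \<le> 2 * I * integral {a..b} (\<lambda>s. norm (f s))"
    using mult_left_mono[OF I(1) I(2)] by (simp add: power2_eq_square)
  also have "\<dots> = integral {a..b} (\<lambda>s. 2 * I * norm (f s))"
    by simp
  also have "\<dots> \<le> integral {a..b} (\<lambda>s. I\<^sup>2 + (norm (f s))\<^sup>2)"
    using sum_squares_bound[of I]
    by (intro integral_le integrable_continuous_interval continuous_intros assms) auto
  also have "\<dots> = I\<^sup>2 * (b - a) + integral {a..b} (\<lambda>s. (norm (f s))\<^sup>2)"
    using assms(2) by (subst integral_add) (auto intro!: int integrable_continuous_interval continuous_intros simp: mult.commute)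
  also have "\<dots> \<le> I\<^sup>2 + integral {a..b} (\<lambda>s. (norm (f s))\<^sup>2)"
    using mult_left_mono[OF assms(3), of "I\<^sup>2"] by simp
  finally show ?thesis by (simp add: I_def)
qed

text \<open>Writing \<open>g k x = g k 0 + \<integral> g' k s ds\<close> over \<open>[0, x]\<close> reduces the estimate, by Fubini,
  to Parseval's identity for every frozen \<open>s\<close>.\<close>

lemma integral_norm_sq_perturbed_trig_poly_le:
  fixes g g' :: "int \<Rightarrow> real \<Rightarrow> complex"
  assumes K: "finite K"
    and deriv: "\<And>k x. k \<in> K \<Longrightarrow> (g k has_vector_derivative g' k x) (at x)"
    and cont: "\<And>k. k \<in> K \<Longrightarrow> continuous_on UNIV (g' k)"
    and bound: "\<And>k x. k \<in> K \<Longrightarrow> norm (g' k x) \<le> B k"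
  shows "integral {-1..1} (\<lambda>x. (norm (\<Sum>k\<in>K. g k x * cis (2 * pi * real_of_int k * x)))\<^sup>2)
    \<le> (\<Sum>k\<in>K. 4 * (norm (g k 0))\<^sup>2 + 8 * (B k)\<^sup>2)"
proof -
  let ?e = "\<lambda>k x. cis (2 * pi * real_of_int k * x)"
  define P where "P x = (\<Sum>k\<in>K. g k 0 * ?e k x)" for x
  define \<phi> where "\<phi> x s = (\<Sum>k\<in>K. g' k s * ?e k x)" for x s
  have contg: "continuous_on S (g k)" if "k \<in> K" for S k
    using deriv[OF that] by (meson continuous_at_imp_continuous_on has_vector_derivative_continuous)
  have cont\<phi>: "continuous_on S (\<phi> x)" for S x
    unfolding \<phi>_def by (intro continuous_intros continuous_on_subset[OF cont]) auto
  have cont\<phi>2: "continuous_on S (\<lambda>(x,s). (norm (\<phi> x s))\<^sup>2)" for S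
    unfolding \<phi>_def case_prod_beta
    by (intro continuous_intros continuous_cis continuous_on_compose2[OF cont]) auto
  have contP: "continuous_on S P" for S
    unfolding P_def by (intro continuous_intros continuous_cis)
  have Pint: "((\<lambda>x. (norm (P x))\<^sup>2) has_integral 2 * (\<Sum>k\<in>K. (norm (g k 0))\<^sup>2)) {-1..1}"
    using has_integral_norm_sq_trig_poly[of "-1" 1 K "\<lambda>k. g k 0"] K unfolding P_def by simp
  have \<phi>int: "integral {-1..1} (\<lambda>x. (norm (\<phi> x s))\<^sup>2) = 2 * (\<Sum>k\<in>K. (norm (g' k s))\<^sup>2)" for s
    using has_integral_norm_sq_trig_poly[of "-1" 1 K "\<lambda>k. g' k s"] K unfolding \<phi>_def
    by (simp add: integral_unique)
  have Q: "(norm ((\<Sum>k\<in>K. g k x * ?e k x) - P x))\<^sup>2 \<le> integral {-1..1} (\<lambda>s. (norm (\<phi> x s))\<^sup>2)"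
    if x: "x \<in> {-1..1}" for x
  proof -
    \<comment> \<open>The endpoints 0 and x are sorted so that negative x is covered too; only the
      sign of the integral changes, and the norm does not see it.\<close>
    define a where "a = min 0 x"
    define b where "b = max 0 x"
    have ab: "a \<le> b" "b - a \<le> 1" "{a..b} \<subseteq> {-1..1}" using x by (auto simp: a_def b_def)
    have "((\<phi> x) has_integral (\<Sum>k\<in>K. (g k b - g k a) * ?e k x)) {a..b}"
      unfolding \<phi>_def
      by (intro has_integral_sum K has_integral_mult_left fundamental_theorem_of_calculus ab)
         (auto intro: has_vector_derivative_at_within deriv)
    then have "integral {a..b} (\<phi> x) = (\<Sum>k\<in>K. (g k b - g k a) * ?e k x)"
      by (rule integral_unique)
    moreover have "(\<Sum>k\<in>K. g k x * ?e k x) - P x = (\<Sum>k\<in>K. (g k x - g k 0) * ?e k x)"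
      by (simp add: P_def sum_subtractf left_diff_distrib)
    moreover have "norm (\<Sum>k\<in>K. (g k x - g k 0) * ?e k x) = norm (\<Sum>k\<in>K. (g k b - g k a) * ?e k x)"
    proof (cases "0 \<le> x")
      case False
      have "(\<Sum>k\<in>K. (g k x - g k 0) * ?e k x) = - (\<Sum>k\<in>K. (g k 0 - g k x) * ?e k x)"
        unfolding sum_negf[symmetric] by (intro sum.cong) (auto simp: algebra_simps)
      with False show ?thesis by (simp add: a_def b_def)
    qed (simp add: a_def b_def)
    ultimately have "(norm ((\<Sum>k\<in>K. g k x * ?e k x) - P x))\<^sup>2 = (norm (integral {a..b} (\<phi> x)))\<^sup>2"
      by simp
    also have "\<dots> \<le> integral {a..b} (\<lambda>s. (norm (\<phi> x s))\<^sup>2)"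
      using ab by (intro norm_integral_sq_le cont\<phi>) auto
    \<comment> \<open>Enlarging the range to all of \<open>{-1..1}\<close> frees it from x, so that
      afterwards the order of integration can be exchanged over a square.\<close>
    also have "\<dots> \<le> integral {-1..1} (\<lambda>s. (norm (\<phi> x s))\<^sup>2)"
      by (intro integral_subset_le ab integrable_continuous_interval continuous_intros cont\<phi>) auto
    finally show ?thesis .
  qed
  have cont\<Phi>: "continuous_on {-1..1} (\<lambda>x. integral {-1..1} (\<lambda>s. (norm (\<phi> x s))\<^sup>2))"
    using integral_continuous_on_param[of "{-1..1}" "-1" "1" "\<lambda>x s. (norm (\<phi> x s))\<^sup>2"] cont\<phi>2
    by simp
  have "integral {-1..1} (\<lambda>x. (norm (\<Sum>k\<in>K. g k x * ?e k x))\<^sup>2)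
     \<le> integral {-1..1} (\<lambda>x. 2 * (norm (P x))\<^sup>2 + 2 * integral {-1..1} (\<lambda>s. (norm (\<phi> x s))\<^sup>2))"
  proof (rule integral_le)
    show "(\<lambda>x. (norm (\<Sum>k\<in>K. g k x * ?e k x))\<^sup>2) integrable_on {-1..1}"
      by (intro integrable_continuous_interval continuous_intros continuous_cis contg)
    show "(\<lambda>x. 2 * (norm (P x))\<^sup>2 + 2 * integral {-1..1} (\<lambda>s. (norm (\<phi> x s))\<^sup>2)) integrable_on {-1..1}"
      by (intro integrable_continuous_interval continuous_intros contP cont\<Phi>)
    fix x :: real assume "x \<in> {-1..1}"
    from Q[OF this] norm_add_sq_le[of "P x" "(\<Sum>k\<in>K. g k x * ?e k x) - P x"]
    show "(norm (\<Sum>k\<in>K. g k x * ?e k x))\<^sup>2 \<le>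
       2 * (norm (P x))\<^sup>2 + 2 * integral {-1..1} (\<lambda>s. (norm (\<phi> x s))\<^sup>2)"
      by simp
  qed
  also have "\<dots> = 2 * integral {-1..1} (\<lambda>x. (norm (P x))\<^sup>2) +
      2 * integral {-1..1} (\<lambda>x. integral {-1..1} (\<lambda>s. (norm (\<phi> x s))\<^sup>2))"
    by (subst integral_add) (auto intro!: integrable_continuous_interval continuous_intros contP cont\<Phi>)
  also have "integral {-1..1} (\<lambda>x. integral {-1..1} (\<lambda>s. (norm (\<phi> x s))\<^sup>2)) =
     integral {-1..1} (\<lambda>s. integral {-1..1} (\<lambda>x. (norm (\<phi> x s))\<^sup>2))"
    using integral_swap_continuous[of "-1" "-1" 1 1 "\<lambda>x s. (norm (\<phi> x s))\<^sup>2"] cont\<phi>2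
    by (simp add: box_real)
  also have "\<dots> = integral {-1..1} (\<lambda>s. 2 * (\<Sum>k\<in>K. (norm (g' k s))\<^sup>2))"
    by (simp add: \<phi>int)
  also have "\<dots> \<le> integral {-1..1} (\<lambda>s::real. 2 * (\<Sum>k\<in>K. (B k)\<^sup>2))"
    by (intro integral_le integrable_continuous_interval continuous_intros continuous_on_subset[OF cont])
       (auto intro!: mult_left_mono sum_mono power_mono bound)
  also have "\<dots> = 4 * (\<Sum>k\<in>K. (B k)\<^sup>2)"
    by simp
  \<comment> \<open>The constants: 4 is 2 from \<open>norm_add_sq_le\<close> times the length 2 of
    the interval; 8 has one more length 2, from the integration over s.\<close>
  finally show ?thesis
    using integral_unique[OF Pint] by (simp add: sum.distrib sum_distrib_left)
qed

section \<open>Operator norm and positive matrices\<close>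

lemma norm_matrix_vector_le_mnorm: "norm (A *v v) \<le> mnorm A * norm v"
  unfolding mnorm_def by (rule onorm) simp

lemma mnorm_nonneg: "0 \<le> mnorm A"
  unfolding mnorm_def by (rule onorm_pos_le) simp

lemma matrix_vector_mult_axis: "(A *v axis j z) $ i = A $ i $ j * z"
  for A :: "'a::comm_semiring_1^'n^'m"
  by (simp add: matrix_vector_mult_def axis_def if_distrib cong: if_cong)

lemma norm_entry_le_mnorm: "norm (A $ i $ j) \<le> mnorm A"
proof -
  have "norm (A $ i $ j) = norm ((A *v axis j 1) $ i)"
    by (simp add: matrix_vector_mult_axis)
  also have "\<dots> \<le> norm (A *v axis j 1)"
    by (rule Finite_Cartesian_Product.norm_nth_le)
  also have "\<dots> \<le> mnorm A"
    using norm_matrix_vector_le_mnorm[of A "axis j 1"]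
    by (simp add: norm_eq_sqrt_inner[of "axis j 1"] inner_axis_axis)
  finally show ?thesis .
qed

lemma norm_matrix_vector_le: "norm (A *v v) \<le> norm A * norm v"
  for A :: "complex^'n^'m"
proof -
  have "norm ((A *v v) $ i) \<le> norm (A $ i) * norm v" for i
  proof -
    have "norm ((A *v v) $ i) \<le> (\<Sum>j\<in>UNIV. \<bar>norm (A $ i $ j)\<bar> * \<bar>norm (v $ j)\<bar>)"
      unfolding matrix_vector_mult_def by (auto intro!: sum_norm_le simp: norm_mult)
    also have "\<dots> \<le> L2_set (\<lambda>j. norm (A $ i $ j)) UNIV * L2_set (\<lambda>j. norm (v $ j)) UNIV"
      by (rule L2_set_mult_ineq)
    finally show ?thesis by (simp add: norm_vec_def)
  qed
  then have "norm (A *v v) \<le> L2_set (\<lambda>i. norm (A $ i) * norm v) UNIV"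
    unfolding norm_vec_def[of "A *v v"] by (intro L2_set_mono) auto
  also have "\<dots> = norm A * norm v"
    by (simp add: norm_vec_def L2_set_left_distrib)
  finally show ?thesis .
qed

text \<open>The type-class norm of a matrix is its Frobenius norm, whose square splits into entries.
  Scalar estimates are made there and reach the operator norm through this inequality;
  \<open>norm_sq_le_mnorm_sq\<close> leads back.\<close>

lemma mnorm_le_norm: "mnorm A \<le> norm A"
  unfolding mnorm_def by (rule onorm_le) (rule norm_matrix_vector_le)

lemma norm_sq_matrix: "(norm A)\<^sup>2 = (\<Sum>i\<in>UNIV. \<Sum>j\<in>UNIV. (norm (A $ i $ j))\<^sup>2)"
  for A :: "complex^'n^'m"
  by (simp add: norm_vec_def L2_set_def sum_nonneg)

lemma norm_sq_le_mnorm_sq: "(norm A)\<^sup>2 \<le> (real CARD('r))\<^sup>2 * (mnorm A)\<^sup>2"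
  for A :: "complex^'r^'r"
proof -
  have "(norm A)\<^sup>2 \<le> (\<Sum>i\<in>(UNIV::'r set). \<Sum>j\<in>(UNIV::'r set). (mnorm A)\<^sup>2)"
    unfolding norm_sq_matrix by (intro sum_mono power_mono norm_entry_le_mnorm) auto
  then show ?thesis by (simp add: power2_eq_square algebra_simps)
qed

lemma mnorm_triangle: "mnorm (A + B) \<le> mnorm A + mnorm B"
  unfolding mnorm_def matrix_vector_mult_add_rdistrib
  by (rule onorm_triangle) auto

lemma mnorm_diff_le: "\<bar>mnorm A - mnorm B\<bar> \<le> norm (A - B)"
  using mnorm_triangle[of "A - B" B] mnorm_triangle[of "B - A" A]
    mnorm_le_norm[of "A - B"] mnorm_le_norm[of "B - A"]
  by (auto simp: norm_minus_commute)

lemma continuous_mnorm: "continuous_on UNIV mnorm"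
  unfolding continuous_on_iff dist_norm real_norm_def
  using mnorm_diff_le le_less_trans by blast

lemma borel_measurable_mnorm [measurable]: "mnorm \<in> borel_measurable borel"
  by (rule borel_measurable_continuous_onI) (rule continuous_mnorm)

text \<open>The type-class inner product is the real part of the Hermitian one. Real parts suffice
  below, because only expansions of squared norms and values of quadratic forms are used.\<close>

lemma inner_cvec: "inner v w = Re (\<Sum>i\<in>UNIV. cnj (v $ i) * w $ i)"
  for v w :: "complex^'n"
  by (simp add: inner_vec_def inner_complex_def)

lemma inner_cadj: "inner (A *v v) w = inner v (cadj A *v w)"
  for A :: "complex^'n^'n"
proof -
  have "(\<Sum>i\<in>UNIV. cnj ((A *v v) $ i) * w $ i)
      = (\<Sum>i\<in>UNIV. \<Sum>j\<in>UNIV. cnj (A $ i $ j) * cnj (v $ j) * w $ i)"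
    by (simp add: matrix_vector_mult_def sum_distrib_right)
  also have "\<dots> = (\<Sum>j\<in>UNIV. \<Sum>i\<in>UNIV. cnj (A $ i $ j) * cnj (v $ j) * w $ i)"
    by (rule sum.swap)
  also have "\<dots> = (\<Sum>j\<in>UNIV. cnj (v $ j) * (cadj A *v w) $ j)"
    by (simp add: matrix_vector_mult_def cadj_def sum_distrib_left mult_ac)
  finally show ?thesis unfolding inner_cvec by simp
qed

lemma mpos_inner_nonneg: "mpos A \<Longrightarrow> 0 \<le> inner v (A *v v)"
  by (simp add: mpos_def inner_cvec)

lemma mpos_selfadjoint: "mpos A \<Longrightarrow> inner (A *v v) w = inner v (A *v w)"
  by (metis inner_cadj mpos_def)

lemma mpos_inner_add:
  assumes "mpos A"
  shows "inner (v + w) (A *v (v + w)) = inner v (A *v v) + 2 * inner v (A *v w) + inner w (A *v w)"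
  using mpos_selfadjoint[OF assms, of v w]
  by (simp add: matrix_vector_right_distrib inner_add_left inner_add_right inner_commute)

text \<open>If w = A v were nonzero, the form at v - t w would be t (t q - 2 |w|^2), with no
  constant term, and hence negative for small t > 0.\<close>

lemma mpos_inner_eq_0:
  assumes "mpos A" and "inner v (A *v v) = 0"
  shows "A *v v = 0"
proof (rule ccontr)
  define w where "w = A *v v"
  define q where "q = inner w (A *v w)"
  assume "A *v v \<noteq> 0"
  then have w: "inner w w > 0" by (simp add: w_def)
  have q: "q \<ge> 0" using assms(1) by (simp add: q_def mpos_inner_nonneg)
  \<comment> \<open>The 1 added to q avoids division by zero and still gives t q \<le>
    |w|^2.\<close>
  define t where "t = inner w w / (q + 1)"
  have t: "t > 0" using w q by (simp add: t_def)
  have vw: "inner v (A *v w) = inner w w"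
    using mpos_selfadjoint[OF assms(1), of v w] by (simp add: w_def)
  have "0 \<le> inner (v + (- t) *\<^sub>R w) (A *v (v + (- t) *\<^sub>R w))"
    by (rule mpos_inner_nonneg[OF assms(1)])
  also have "\<dots> = - 2 * t * inner w w + t\<^sup>2 * q"
    unfolding mpos_inner_add[OF assms(1)] assms(2)
    using linear_cmul[OF matrix_vector_mul_linear, of A "-t" w]
    by (simp add: vw q_def power2_eq_square)
  also have "\<dots> = t * (t * q - 2 * inner w w)"
    by (simp add: power2_eq_square algebra_simps)
  finally have "2 * inner w w \<le> t * q"
    using t by (simp add: zero_le_mult_iff)
  also have "\<dots> \<le> inner w w"
    using q w by (simp add: t_def field_simps)
  finally show False using w by simp
qed

text \<open>Testing the form on e_p + u e_q with u = 1, -1 bounds the real part of the entry by half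
  the sum of the two diagonal entries; u = \<i>, -\<i> does the same for the imaginary part.\<close>

lemma mpos_entry_le:
  assumes "mpos A"
  shows "norm (A $ p $ q) \<le> Re (A $ p $ p) + Re (A $ q $ q)"
proof -
  have ax: "inner (axis p z) (A *v axis q w) = Re (cnj z * (A $ p $ q * w))" for z w p q
    unfolding inner_axis' by (simp add: matrix_vector_mult_axis inner_complex_def)
  have abs_bound: "\<bar>y\<bar> \<le> (a + b) / 2" if "0 \<le> a + 2 * y + b" "0 \<le> a + - (2 * y) + b" for a b y :: real
    using that by (simp add: abs_le_iff field_simps)
  have *: "\<bar>Re (A $ p $ q * w)\<bar> \<le> (Re (A $ p $ p) + Re (A $ q $ q)) / 2" if w: "w = 1 \<or> w = \<i>" for w
  proof -
    have w1: "Re (cnj u * (A $ q $ q * u)) = Re (A $ q $ q)" if "u = w \<or> u = - w" for u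
      using that w by auto
    have "0 \<le> Re (A $ p $ p) + 2 * Re (A $ p $ q * u) + Re (A $ q $ q)" if "u = w \<or> u = - w" for u
      using mpos_inner_nonneg[OF assms, of "axis p 1 + axis q u"] w1[OF that]
      unfolding mpos_inner_add[OF assms] ax by simp
    from this[OF disjI1[OF refl]] this[OF disjI2[OF refl]] show ?thesis
      unfolding mult_minus_right uminus_complex.sel by (rule abs_bound)
  qed
  have "norm (A $ p $ q) \<le> \<bar>Re (A $ p $ q)\<bar> + \<bar>Im (A $ p $ q)\<bar>"
    by (rule cmod_le)
  with *[of 1] *[of \<i>] show ?thesis by simp
qed

section \<open>Completeness of $L_2$\<close>

lemma tendsto_ennreal_0I:
  fixes g :: "'b \<Rightarrow> ennreal"
  assumes "\<And>e. 0 < e \<Longrightarrow> eventually (\<lambda>x. g x \<le> ennreal e) F"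
  shows "(g \<longlongrightarrow> 0) F"
proof (rule order_tendstoI)
  fix a :: ennreal assume "0 < a"
  then obtain b where b: "0 < b" "b < a" using dense by blast
  then have "b < top" using less_le_trans top_greatest by blast
  then obtain e where e: "b = ennreal e" "0 \<le> e" by (cases b) auto
  with b have "0 < e" by (cases "e = 0") auto
  then show "eventually (\<lambda>x. g x < a) F"
    using assms[of e] b e by (auto elim!: eventually_mono)
qed simp

lemma (in finite_measure) nn_integral_norm_sq_le:
  fixes f :: "'a \<Rightarrow> 'b::{real_normed_vector, second_countable_topology}"
  assumes [measurable]: "f \<in> borel_measurable M"
  shows "(\<integral>\<^sup>+x. ennreal (norm (f x)) \<partial>M)\<^sup>2 \<le> (\<integral>\<^sup>+x. ennreal ((norm (f x))\<^sup>2) \<partial>M) * emeasure M (space M)"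
  using Cauchy_Schwarz_nn_integral[of "\<lambda>x. norm (f x)" M "\<lambda>_. 1"]
  by (simp add: ennreal_power)

lemma (in finite_measure) L2_imp_integrable:
  fixes f :: "'a \<Rightarrow> 'b::{banach, second_countable_topology}"
  assumes [measurable]: "f \<in> borel_measurable M"
    and "(\<integral>\<^sup>+x. ennreal ((norm (f x))\<^sup>2) \<partial>M) < \<infinity>"
  shows "integrable M f"
proof -
  have "(\<integral>\<^sup>+x. ennreal (norm (f x)) \<partial>M)\<^sup>2 < \<infinity>"
  proof (rule le_less_trans[OF nn_integral_norm_sq_le[OF assms(1)]])
    have "emeasure M (space M) < \<infinity>"
      using finite_emeasure_space by (metis infinity_ennreal_def top.not_eq_extremum)
    with assms(2) show "(\<integral>\<^sup>+x. ennreal ((norm (f x))\<^sup>2) \<partial>M) * emeasure M (space M) < \<infinity>"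
      by (simp add: ennreal_mult_less_top)
  qed
  then show ?thesis
    by (simp add: integrable_iff_bounded power_less_top_ennreal)
qed

text \<open>Riesz--Fischer: a subsequence converges almost everywhere, and Fatou's lemma identifies
  its limit as the limit in quadratic mean.\<close>

lemma (in finite_measure) L2_complete:
  fixes F :: "nat \<Rightarrow> 'a \<Rightarrow> 'b::{banach, second_countable_topology}"
  assumes meas: "\<And>n. F n \<in> borel_measurable M"
    and fin: "\<And>n. (\<integral>\<^sup>+x. ennreal ((norm (F n x))\<^sup>2) \<partial>M) < \<infinity>"
    and cauchy: "\<And>e. 0 < e \<Longrightarrow>
      \<exists>N. \<forall>m\<ge>N. \<forall>n\<ge>N. (\<integral>\<^sup>+x. ennreal ((norm (F m x - F n x))\<^sup>2) \<partial>M) \<le> ennreal e"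
  obtains H where "H \<in> borel_measurable M"
    "(\<lambda>n. \<integral>\<^sup>+x. ennreal ((norm (F n x - H x))\<^sup>2) \<partial>M) \<longlonglongrightarrow> 0"
proof -
  note [measurable] = meas
  have int: "integrable M (F n)" for n
    by (rule L2_imp_integrable[OF meas fin])
  \<comment> \<open>The added 1 makes c positive even on a null space, so that one can divide by it.
    With the L_2 threshold (e/2)^2 / c, Cauchy-Schwarz against 1 gives L_1 distance at most e/2, and
    L_1 Cauchy sequences have subsequences that are Cauchy almost everywhere.\<close>
  define c where "c = measure M (space M) + 1"
  have c: "c > 0" "emeasure M (space M) \<le> ennreal c"
    by (auto simp: c_def emeasure_eq_measure intro: ennreal_leI add_nonneg_pos)
  have "\<exists>N. \<forall>i\<ge>N. \<forall>j\<ge>N. (LINT x|M. norm (F i x - F j x)) < e" if e: "e > 0" for e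
  proof -
    have "(e/2)\<^sup>2 / c > 0" using e c by simp
    from cauchy[OF this] obtain N where N: "\<And>m n. m \<ge> N \<Longrightarrow> n \<ge> N \<Longrightarrow>
       (\<integral>\<^sup>+x. ennreal ((norm (F m x - F n x))\<^sup>2) \<partial>M) \<le> ennreal ((e/2)\<^sup>2 / c)"
      by blast
    have "(LINT x|M. norm (F i x - F j x)) < e" if ij: "i \<ge> N" "j \<ge> N" for i j
    proof -
      have "integrable M (\<lambda>x. norm (F i x - F j x))"
        by (intro integrable_norm Bochner_Integration.integrable_diff int)
      then have eq: "(\<integral>\<^sup>+x. ennreal (norm (F i x - F j x)) \<partial>M) = ennreal (LINT x|M. norm (F i x - F j x))"
        by (rule nn_integral_eq_integral) simp
      have "(\<integral>\<^sup>+x. ennreal (norm (F i x - F j x)) \<partial>M)\<^sup>2 \<le>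
         (\<integral>\<^sup>+x. ennreal ((norm (F i x - F j x))\<^sup>2) \<partial>M) * emeasure M (space M)"
        by (rule nn_integral_norm_sq_le) simp
      also have "\<dots> \<le> ennreal ((e/2)\<^sup>2 / c) * ennreal c"
        by (intro mult_mono N ij c) auto
      also have "\<dots> = ennreal ((e/2)\<^sup>2)"
        using c by (simp flip: ennreal_mult'')
      finally have "(LINT x|M. norm (F i x - F j x))\<^sup>2 \<le> (e/2)\<^sup>2"
        unfolding eq by (simp add: ennreal_power)
      then have "(LINT x|M. norm (F i x - F j x)) \<le> e/2"
        using e by (simp add: power2_le_iff_abs_le)
      then show ?thesis using e by simp
    qed
    then show ?thesis by blast
  qed
  from cauchy_L1_AE_cauchy_subseq[OF int this]
  obtain r where r: "strict_mono r" "AE x in M. Cauchy (\<lambda>i. F (r i) x)" by blast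
  define H where "H x = lim (\<lambda>i. F (r i) x)" for x
  have H[measurable]: "H \<in> borel_measurable M"
    unfolding H_def by measurable
  have lim: "AE x in M. (\<lambda>i. F (r i) x) \<longlonglongrightarrow> H x"
    using r(2) by eventually_elim (simp add: H_def Cauchy_convergent_iff convergent_LIMSEQ_iff)
  have "(\<lambda>n. \<integral>\<^sup>+x. ennreal ((norm (F n x - H x))\<^sup>2) \<partial>M) \<longlonglongrightarrow> 0"
  proof (rule tendsto_ennreal_0I)
    fix e :: real assume "e > 0"
    from cauchy[OF this] obtain N where N: "\<And>m n. m \<ge> N \<Longrightarrow> n \<ge> N \<Longrightarrow>
       (\<integral>\<^sup>+x. ennreal ((norm (F m x - F n x))\<^sup>2) \<partial>M) \<le> ennreal e" by blast
    have "(\<integral>\<^sup>+x. ennreal ((norm (F n x - H x))\<^sup>2) \<partial>M) \<le> ennreal e" if n: "n \<ge> N" for n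
    proof -
      have "(\<integral>\<^sup>+x. ennreal ((norm (F n x - H x))\<^sup>2) \<partial>M) =
         (\<integral>\<^sup>+x. liminf (\<lambda>i. ennreal ((norm (F n x - F (r i) x))\<^sup>2)) \<partial>M)"
      proof (rule nn_integral_cong_AE)
        show "AE x in M. ennreal ((norm (F n x - H x))\<^sup>2) =
          liminf (\<lambda>i. ennreal ((norm (F n x - F (r i) x))\<^sup>2))"
          using lim
        proof eventually_elim
          case (elim x)
          have "(\<lambda>i. ennreal ((norm (F n x - F (r i) x))\<^sup>2)) \<longlonglongrightarrow> ennreal ((norm (F n x - H x))\<^sup>2)"
            by (intro tendsto_ennrealI tendsto_intros elim)
          then show ?case by (intro lim_imp_Liminf[symmetric]) auto
        qed
      qed
      also have "\<dots> \<le> liminf (\<lambda>i. \<integral>\<^sup>+x. ennreal ((norm (F n x - F (r i) x))\<^sup>2) \<partial>M)"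
        by (rule nn_integral_liminf) simp
      also have "\<dots> \<le> limsup (\<lambda>i. \<integral>\<^sup>+x. ennreal ((norm (F n x - F (r i) x))\<^sup>2) \<partial>M)"
        by (rule Liminf_le_Limsup) simp
      also have "\<dots> \<le> ennreal e"
      proof (rule Limsup_bounded)
        show "\<forall>\<^sub>F i in sequentially. (\<integral>\<^sup>+x. ennreal ((norm (F n x - F (r i) x))\<^sup>2) \<partial>M) \<le> ennreal e"
          using eventually_ge_at_top[of N]
        proof eventually_elim
          case (elim i)
          then show ?case using N[OF n, of "r i"] seq_suble[OF r(1), of i] by simp
        qed
      qed
      finally show ?thesis .
    qed
    then show "\<forall>\<^sub>F n in sequentially. (\<integral>\<^sup>+x. ennreal ((norm (F n x - H x))\<^sup>2) \<partial>M) \<le> ennreal e"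
      by (auto simp: eventually_sequentially)
  qed
  with H that show ?thesis by blast
qed

section \<open>Convergence of the partial sums\<close>

definition nodes :: "(int \<Rightarrow> real) \<Rightarrow> int \<Rightarrow> int set" where
  "nodes lam k = {j. lam j \<in> Delta k}"

text \<open>\<open>Delta k\<close> contains exactly one atom of mu_0, namely pi k, so the block sets
  the nodes of the interval against that single atom.\<close>

definition block :: "(int \<Rightarrow> real) \<Rightarrow> (int \<Rightarrow> complex^'r^'r) \<Rightarrow> int \<Rightarrow> real \<Rightarrow> complex^'r^'r" where
  "block lam alpha k x =
     (\<Sum>j\<in>nodes lam k. mscale (cis (2 * lam j * x)) (alpha j)) - mscale (cis (2 * pi * real_of_int k * x)) (mat 1)"

lemma mscale_nth [simp]: "mscale c A $ p $ q = c * A $ p $ q"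
  by (simp add: mscale_def)

lemma mscale_sum_left: "mscale (\<Sum>k\<in>K. c k) A = (\<Sum>k\<in>K. mscale (c k) A)"
  by (simp add: vec_eq_iff sum_distrib_right)

lemma ex_Delta: "\<exists>k. x \<in> Delta k"
proof
  \<comment> \<open>Ceiling rather than floor, since \<open>Delta k\<close> is open on the left and
    closed on the right.\<close>
  let ?k = "\<lceil>x / pi - 1/2\<rceil>"
  have "of_int ?k < x / pi + 1/2" "x / pi - 1/2 \<le> of_int ?k" by linarith+
  then have "pi * of_int ?k < pi * (x / pi + 1/2)" "pi * (x / pi - 1/2) \<le> pi * of_int ?k"
    by (simp_all only: mult_less_cancel_left_pos[OF pi_gt_zero] mult_le_cancel_left_pos[OF pi_gt_zero])
  then show "x \<in> Delta ?k" by (simp add: Delta_def distrib_left right_diff_distrib)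
qed

lemma Delta_disjoint:
  assumes "x \<in> Delta k" "x \<in> Delta l"
  shows "k = l"
proof -
  have "pi * real_of_int k < pi * (real_of_int l + 1)" "pi * real_of_int l < pi * (real_of_int k + 1)"
    using assms by (auto simp: Delta_def algebra_simps)
  then have "real_of_int k < real_of_int l + 1" "real_of_int l < real_of_int k + 1"
    by simp_all
  then show ?thesis by linarith
qed

text \<open>The window starts where \<open>Delta (1 - n)\<close> starts and ends where
  \<open>Delta n\<close> ends, so no interval is cut. This is the source of the asymmetric index
  range; for n = 0 both sides are empty.\<close>

lemma window_iff_Delta:
  assumes "x \<in> Delta k"
  shows "x \<in> {- pi * (real n - 1/2) <.. pi * (real n + 1/2)} \<longleftrightarrow> k \<in> {1 - int n..int n}"
proof
  assume "x \<in> {- pi * (real n - 1/2) <.. pi * (real n + 1/2)}"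
  with assms have "pi * (- real n) < pi * real_of_int k" "pi * real_of_int k < pi * (real n + 1)"
    by (auto simp: Delta_def algebra_simps)
  then have "- real n < real_of_int k" "real_of_int k < real n + 1"
    by (simp_all only: mult_less_cancel_left_pos[OF pi_gt_zero])
  then show "k \<in> {1 - int n..int n}" by simp
next
  assume "k \<in> {1 - int n..int n}"
  then have "1 - real n \<le> real_of_int k" "real_of_int k \<le> real n" by auto
  then have "pi * (1 - real n) \<le> pi * real_of_int k" "pi * real_of_int k \<le> pi * real n"
    by (simp_all only: mult_le_cancel_left_pos[OF pi_gt_zero])
  moreover have "pi * real_of_int k - pi / 2 < x" "x \<le> pi * real_of_int k + pi / 2"
    using assms by (simp_all add: Delta_def)
  ultimately show "x \<in> {- pi * (real n - 1/2) <.. pi * (real n + 1/2)}"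
    unfolding greaterThanAtMost_iff right_diff_distrib distrib_left by linarith
qed

lemma nodes_window:
  "{j. lam j \<in> {- pi * (real n - 1/2) <.. pi * (real n + 1/2)}} = (\<Union>k\<in>{1 - int n..int n}. nodes lam k)"
proof (intro set_eqI iffI)
  fix j assume "j \<in> {j. lam j \<in> {- pi * (real n - 1/2) <.. pi * (real n + 1/2)}}"
  moreover obtain k where "lam j \<in> Delta k" using ex_Delta by blast
  ultimately show "j \<in> (\<Union>k\<in>{1 - int n..int n}. nodes lam k)"
    using window_iff_Delta by (auto simp: nodes_def)
next
  fix j assume "j \<in> (\<Union>k\<in>{1 - int n..int n}. nodes lam k)"
  then show "j \<in> {j. lam j \<in> {- pi * (real n - 1/2) <.. pi * (real n + 1/2)}}"
    unfolding nodes_def using window_iff_Delta by blast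
qed

lemma int_window: "{k::int. pi * k \<in> {- pi * (real n - 1/2) <.. pi * (real n + 1/2)}} = {1 - int n..int n}"
proof -
  have "pi * real_of_int k \<in> Delta k" for k by (simp add: Delta_def)
  from window_iff_Delta[OF this] show ?thesis by blast
qed

lemma sum_nodes_window:
  assumes "\<And>k. finite (nodes lam k)"
  shows "(\<Sum>j\<in>(\<Union>k\<in>{1 - int n..int n}. nodes lam k). f j) = (\<Sum>k\<in>{1 - int n..int n}. \<Sum>j\<in>nodes lam k. f j)"
  by (rule sum.UNION_disjoint) (use assms Delta_disjoint in \<open>auto simp: nodes_def\<close>)

lemma exp_eq_cis: "exp (2 * \<i> * complex_of_real (a * x)) = cis (2 * a * x)"
  by (simp add: cis_conv_exp mult_ac)

lemma Hpart_eq_sum_block: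
  assumes "\<And>k. finite (nodes lam k)"
  shows "Hpart lam alpha n x = (\<Sum>k\<in>{1 - int n..int n}. block lam alpha k x)"
  unfolding Hpart_def Let_def int_window nodes_window sum_nodes_window[OF assms] exp_eq_cis
    block_def sum_subtractf mscale_sum_left
  by (simp add: mult_ac)

text \<open>The summable weights \<open>w k\<close> make the blocks behave like an orthogonal
  family, and any tail of the sums becomes small. Each entry of a block is a factor \<open>g\<close>
  times an exponential of period 1. The size of \<open>g\<close> at 0 is at most
  \<open>\<eta> k\<close>, and its derivative is bounded by \<open>B k\<close>, whose square
  Cauchy-Schwarz over at most C nodes bounds by a multiple of \<open>d k\<close>.\<close>

lemma condA1_bounds:
  fixes alpha :: "int \<Rightarrow> complex^'r^'r"
  assumes A1: "condA1 lam alpha" and pos: "\<And>j. mpos (alpha j)"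
  obtains w :: "int \<Rightarrow> real" where "w summable_on UNIV" "\<And>k. 0 \<le> w k"
    "\<And>K. finite K \<Longrightarrow> integral {-1..1} (\<lambda>x. (norm (\<Sum>k\<in>K. block lam alpha k x))\<^sup>2) \<le> sum w K"
proof -
  define \<eta> where "\<eta> k = mnorm (mat 1 - (\<Sum>j\<in>nodes lam k. alpha j))" for k
  define d where "d k = (\<Sum>j\<in>nodes lam k. (lam j - pi * real_of_int k)\<^sup>2)" for k
  from A1 obtain C where fin: "\<And>k. finite (nodes lam k)" and C: "\<And>k. card (nodes lam k) \<le> C"
    and d: "d summable_on UNIV" and \<eta>: "(\<lambda>k. (\<eta> k)\<^sup>2) summable_on UNIV"
    unfolding condA1_def nodes_def[symmetric] d_def[symmetric] \<eta>_def[symmetric] by blast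
  have d0: "d k \<ge> 0" for k by (simp add: d_def sum_nonneg)
  define E where "E = infsum (\<lambda>k. (\<eta> k)\<^sup>2) UNIV"
  have \<eta>E: "\<eta> k \<le> 1 + E" for k
  proof -
    have "(\<Sum>k\<in>{k}. (\<eta> k)\<^sup>2) \<le> E"
      unfolding E_def by (rule finite_sum_le_infsum[OF \<eta>]) auto
    moreover have "2 * \<eta> k \<le> 1 + (\<eta> k)\<^sup>2"
      using sum_squares_bound[of "\<eta> k" 1] by simp
    moreover have "0 \<le> \<eta> k" by (simp add: \<eta>_def mnorm_nonneg)
    ultimately show ?thesis by simp
  qed
  \<comment> \<open>A diagonal entry of one \<open>alpha j\<close> is at most 1 +
    \<open>\<eta> k\<close> \<le> 2 + E, since the other nodes of its block contribute nonnegative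
    amounts. The factor 2 comes from \<open>mpos_entry_le\<close>, which adds two diagonal
    entries.\<close>
  define M where "M = 2 * (2 + E)"
  have diag: "0 \<le> Re (alpha j $ p $ p)" for j p
    using mpos_inner_nonneg[OF pos[of j], of "axis p 1"]
    unfolding inner_axis' by (simp add: matrix_vector_mult_axis inner_complex_def)
  have diagM: "Re (alpha j $ p $ p) \<le> 2 + E" for j p
  proof -
    obtain k where k: "j \<in> nodes lam k" using ex_Delta unfolding nodes_def by blast
    have "Re (alpha j $ p $ p) \<le> (\<Sum>j\<in>nodes lam k. Re (alpha j $ p $ p))"
      using member_le_sum[OF k, of "\<lambda>j. Re (alpha j $ p $ p)"] diag fin by simp
    also have "\<dots> = 1 - Re ((mat 1 - (\<Sum>j\<in>nodes lam k. alpha j)) $ p $ p)"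
      by (simp add: mat_def)
    also have "\<dots> \<le> 1 + norm ((mat 1 - (\<Sum>j\<in>nodes lam k. alpha j)) $ p $ p)"
      using abs_Re_le_cmod[of "(mat 1 - (\<Sum>j\<in>nodes lam k. alpha j)) $ p $ p"] by linarith
    also have "\<dots> \<le> 1 + \<eta> k"
      unfolding \<eta>_def by (intro add_left_mono norm_entry_le_mnorm)
    finally show ?thesis using \<eta>E[of k] by simp
  qed
  have M: "norm (alpha j $ p $ q) \<le> M" for j p q
    using mpos_entry_le[OF pos[of j], of p q] diagM[of j p] diagM[of j q] by (simp add: M_def)
  have M0: "M \<ge> 0" using M order_trans norm_ge_zero by blast
  \<comment> \<open>The leading factor counts the matrix entries; 4 and 8 come from
    \<open>integral_norm_sq_perturbed_trig_poly_le\<close>, and 32 is 8 times the 4 in the bound for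
    the square of \<open>B k\<close>.\<close>
  define w where "w k = (real CARD('r))\<^sup>2 * (4 * (\<eta> k)\<^sup>2 + 32 * M\<^sup>2 * C * d k)" for k
  define g where "g p q k x = (\<Sum>j\<in>nodes lam k. alpha j $ p $ q * cis (2 * (lam j - pi * real_of_int k) * x)) - mat 1 $ p $ q"
    for p q :: 'r and k x
  define g' where "g' p q k x = (\<Sum>j\<in>nodes lam k. alpha j $ p $ q *
      (cis (2 * (lam j - pi * real_of_int k) * x) * (\<i> * of_real (2 * (lam j - pi * real_of_int k)))))"
    for p q :: 'r and k x
  define B where "B k = 2 * M * (\<Sum>j\<in>nodes lam k. \<bar>lam j - pi * real_of_int k\<bar>)" for k
  have entry: "block lam alpha k x $ p $ q = g p q k x * cis (2 * pi * real_of_int k * x)" for k x p q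
  proof -
    have "cis (2 * lam j * x) = cis (2 * (lam j - pi * real_of_int k) * x) * cis (2 * pi * real_of_int k * x)" for j
      by (simp add: cis_mult algebra_simps)
    then show ?thesis
      by (simp add: block_def g_def left_diff_distrib right_diff_distrib sum_distrib_right sum_distrib_left mult_ac)
  qed
  have g0: "(norm (g p q k 0))\<^sup>2 \<le> (\<eta> k)\<^sup>2" for p q k
  proof -
    have "norm (g p q k 0) = norm ((mat 1 - (\<Sum>j\<in>nodes lam k. alpha j)) $ p $ q)"
      by (simp add: g_def norm_minus_commute)
    also have "\<dots> \<le> \<eta> k" unfolding \<eta>_def by (rule norm_entry_le_mnorm)
    finally show ?thesis by (intro power_mono) auto
  qed
  have deriv: "(g p q k has_vector_derivative g' p q k x) (at x)" for p q k x
  proof -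
    have cis': "((\<lambda>x. cis (c * x)) has_vector_derivative cis (c * x) * (\<i> * of_real c)) (at x)" for c :: real
    proof -
      have "((\<lambda>z. exp (\<i> * of_real c * z)) has_field_derivative cis (c * x) * (\<i> * of_real c)) (at (of_real x))"
        by (auto intro!: derivative_eq_intros simp: cis_conv_exp mult_ac)
      from has_vector_derivative_real_field[OF this] show ?thesis
        by (simp add: cis_conv_exp mult_ac)
    qed
    have "((\<lambda>x. (\<Sum>j\<in>nodes lam k. alpha j $ p $ q * cis (2 * (lam j - pi * real_of_int k) * x)) - mat 1 $ p $ q)
       has_vector_derivative g' p q k x - 0) (at x)"
      unfolding g'_def
      by (intro has_vector_derivative_diff has_vector_derivative_sum has_vector_derivative_mult_right
          has_vector_derivative_const cis')
    then show ?thesis by (simp add: g_def[abs_def])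
  qed
  have cont: "continuous_on UNIV (g' p q k)" for p q k
    unfolding g'_def cis_conv_exp by (intro continuous_intros)
  have bound: "norm (g' p q k x) \<le> B k" for p q k x
  proof -
    have "norm (g' p q k x) \<le> (\<Sum>j\<in>nodes lam k. M * (2 * \<bar>lam j - pi * real_of_int k\<bar>))"
      unfolding g'_def
    proof (rule sum_norm_le)
      fix j
      have "norm (alpha j $ p $ q) * (2 * \<bar>lam j - pi * real_of_int k\<bar>) \<le> M * (2 * \<bar>lam j - pi * real_of_int k\<bar>)"
        by (intro mult_right_mono M) auto
      then show "norm (alpha j $ p $ q * (cis (2 * (lam j - pi * real_of_int k) * x) *
          (\<i> * of_real (2 * (lam j - pi * real_of_int k))))) \<le> M * (2 * \<bar>lam j - pi * real_of_int k\<bar>)"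
        unfolding norm_mult norm_of_real norm_cis norm_ii abs_mult abs_numeral mult_1 .
    qed
    then show ?thesis by (simp add: B_def sum_distrib_left mult_ac)
  qed
  have B: "(B k)\<^sup>2 \<le> 4 * M\<^sup>2 * C * d k" for k
  proof -
    have "(\<Sum>j\<in>nodes lam k. \<bar>lam j - pi * real_of_int k\<bar> * 1)\<^sup>2 \<le>
      (\<Sum>j\<in>nodes lam k. \<bar>lam j - pi * real_of_int k\<bar>\<^sup>2) * (\<Sum>j\<in>nodes lam k. 1\<^sup>2)"
      by (rule Cauchy_Schwarz_ineq_sum)
    also have "\<dots> = d k * card (nodes lam k)" by (simp add: d_def)
    also have "\<dots> \<le> d k * C" by (intro mult_left_mono d0) (simp add: C)
    finally have "(\<Sum>j\<in>nodes lam k. \<bar>lam j - pi * real_of_int k\<bar>)\<^sup>2 \<le> C * d k"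
      by (simp add: mult.commute)
    from mult_left_mono[OF this, of "4 * M\<^sup>2"] show ?thesis
      by (simp add: B_def power_mult_distrib mult_ac)
  qed
  show ?thesis
  proof
    show "w summable_on UNIV"
      unfolding w_def by (intro summable_on_cmult_right summable_on_add \<eta> d)
    show "0 \<le> w k" for k using M0 d0[of k] by (simp add: w_def)
    fix K :: "int set" assume K: "finite K"
    have contg: "continuous_on S (g p q k)" for p q k S
      using deriv[of p q k] by (meson continuous_at_imp_continuous_on has_vector_derivative_continuous)
    have "integral {-1..1} (\<lambda>x. (norm (\<Sum>k\<in>K. block lam alpha k x))\<^sup>2) =
      integral {-1..1} (\<lambda>x. \<Sum>p\<in>UNIV. \<Sum>q\<in>UNIV. (norm (\<Sum>k\<in>K. g p q k x * cis (2 * pi * real_of_int k * x)))\<^sup>2)"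
      by (simp add: norm_sq_matrix entry)
    also have "\<dots> = (\<Sum>p\<in>UNIV. \<Sum>q\<in>UNIV. integral {-1..1} (\<lambda>x. (norm (\<Sum>k\<in>K. g p q k x * cis (2 * pi * real_of_int k * x)))\<^sup>2))"
      by (simp add: Henstock_Kurzweil_Integration.integral_sum integrable_sum integrable_continuous_interval
          continuous_intros contg cis_conv_exp)
    also have "\<dots> \<le> (\<Sum>p\<in>(UNIV::'r set). \<Sum>q\<in>(UNIV::'r set). \<Sum>k\<in>K. 4 * (\<eta> k)\<^sup>2 + 32 * M\<^sup>2 * C * d k)"
    proof (intro sum_mono)
      fix p q :: 'r
      have "integral {-1..1} (\<lambda>x. (norm (\<Sum>k\<in>K. g p q k x * cis (2 * pi * real_of_int k * x)))\<^sup>2)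
         \<le> (\<Sum>k\<in>K. 4 * (norm (g p q k 0))\<^sup>2 + 8 * (B k)\<^sup>2)"
        by (rule integral_norm_sq_perturbed_trig_poly_le[OF K deriv cont bound])
      also have "\<dots> \<le> (\<Sum>k\<in>K. 4 * (\<eta> k)\<^sup>2 + 32 * M\<^sup>2 * C * d k)"
      proof (rule sum_mono)
        fix k show "4 * (norm (g p q k 0))\<^sup>2 + 8 * (B k)\<^sup>2 \<le> 4 * (\<eta> k)\<^sup>2 + 32 * M\<^sup>2 * C * d k"
          using g0[of p q k] B[of k] by simp
      qed
      finally show "integral {-1..1} (\<lambda>x. (norm (\<Sum>k\<in>K. g p q k x * cis (2 * pi * real_of_int k * x)))\<^sup>2)
        \<le> (\<Sum>k\<in>K. 4 * (\<eta> k)\<^sup>2 + 32 * M\<^sup>2 * C * d k)" .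
    qed
    also have "\<dots> = sum w K"
      by (simp add: w_def sum_distrib_left power2_eq_square mult.assoc)
    finally show "integral {-1..1} (\<lambda>x. (norm (\<Sum>k\<in>K. block lam alpha k x))\<^sup>2) \<le> sum w K" .
  qed
qed

section \<open>Passage to the limit in L_2\<close>

lemma L2_complete_lebesgue:
  fixes F :: "nat \<Rightarrow> real \<Rightarrow> 'a::euclidean_space"
  assumes S: "S \<in> lmeasurable"
    and meas: "\<And>n. F n \<in> borel_measurable (lebesgue_on S)"
    and fin: "\<And>n. (\<integral>\<^sup>+x\<in>S. ennreal ((norm (F n x))\<^sup>2) \<partial>lebesgue) < \<infinity>"
    and cauchy: "\<And>e. 0 < e \<Longrightarrow>
      \<exists>N. \<forall>m\<ge>N. \<forall>n\<ge>N. (\<integral>\<^sup>+x\<in>S. ennreal ((norm (F m x - F n x))\<^sup>2) \<partial>lebesgue) \<le> ennreal e"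
  obtains H where "H \<in> borel_measurable (lebesgue_on S)"
    "(\<lambda>n. \<integral>\<^sup>+x\<in>S. ennreal ((norm (F n x - H x))\<^sup>2) \<partial>lebesgue) \<longlonglongrightarrow> 0"
proof -
  have eq: "(\<integral>\<^sup>+x\<in>S. g x \<partial>lebesgue) = (\<integral>\<^sup>+x. g x \<partial>lebesgue_on S)" for g
    using S by (subst nn_integral_restrict_space) auto
  interpret finite_measure "lebesgue_on S" by (rule finite_measure_lebesgue_on[OF S])
  show ?thesis
    using L2_complete[OF meas fin[unfolded eq] cauchy[unfolded eq]] that unfolding eq by blast
qed

lemma continuous_block: "continuous_on S (block lam alpha k)"
proof -
  have "continuous_on S (\<lambda>x. block lam alpha k x $ p $ q)" for p q
    unfolding block_def vector_minus_component sum_component mscale_nth cis_conv_exp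
    by (intro continuous_intros)
  then have "continuous_on S (\<lambda>x. \<chi> p q. block lam alpha k x $ p $ q)"
    by (intro continuous_on_vec_lambda)
  then show ?thesis by simp
qed

lemma set_nn_integral_continuous_le:
  fixes f :: "real \<Rightarrow> real"
  assumes "continuous_on {a..b} f" "\<And>x. 0 \<le> f x"
  shows "(\<integral>\<^sup>+x\<in>{a<..<b}. ennreal (f x) \<partial>lebesgue) \<le> ennreal (integral {a..b} f)"
proof -
  have "(\<integral>\<^sup>+x\<in>{a<..<b}. ennreal (f x) \<partial>lebesgue) \<le> (\<integral>\<^sup>+x\<in>{a..b}. ennreal (f x) \<partial>lebesgue)"
    by (intro nn_integral_mono) (auto simp: indicator_def)
  also have "\<dots> = ennreal (integral {a..b} f)"
    unfolding nn_integral_completion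
    by (rule nn_integral_has_integral_lebesgue')
       (use assms in \<open>auto intro: integrable_integral integrable_continuous_interval\<close>)
  finally show ?thesis .
qed

text \<open>Cauchy criterion for unordered sums: if F already collects the total up to e, a set
  disjoint from F can add less than e, since its union with F stays below the total.\<close>

lemma summable_on_sum_disjoint_small:
  fixes w :: "'b \<Rightarrow> real"
  assumes "w summable_on UNIV" "\<And>k. 0 \<le> w k" "0 < e"
  obtains F where "finite F" "\<And>K. finite K \<Longrightarrow> K \<inter> F = {} \<Longrightarrow> sum w K < e"
proof -
  define s where "s = infsum w UNIV"
  have "(w has_sum s) UNIV" using assms(1) by (simp add: s_def)
  then have "(sum w \<longlongrightarrow> s) (finite_subsets_at_top UNIV)" by (simp add: has_sum_def)
  then have "eventually (\<lambda>F. s - e < sum w F) (finite_subsets_at_top UNIV)"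
    using assms(3) by (intro order_tendstoD(1)) auto
  then obtain F where F: "finite F" "s - e < sum w F"
    by (auto simp: eventually_finite_subsets_at_top)
  have "sum w K < e" if "finite K" "K \<inter> F = {}" for K
  proof -
    have "sum w (K \<union> F) \<le> s"
      unfolding s_def using that F assms by (intro finite_sum_le_infsum) auto
    then show ?thesis using that F by (simp add: sum.union_disjoint)
  qed
  with F that show ?thesis by blast
qed

lemma sq_int_mnorm_iff:
  fixes H :: "real \<Rightarrow> complex^'r^'r"
  assumes "S \<in> sets lebesgue"
  shows "sq_int S mnorm H \<longleftrightarrow> H \<in> borel_measurable (lebesgue_on S) \<and>
    (\<integral>\<^sup>+x\<in>S. ennreal ((mnorm (H x))\<^sup>2) \<partial>lebesgue) < \<infinity>"
  unfolding sq_int_def set_borel_measurable_def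
  using assms by (subst borel_measurable_restrict_space_iff) auto

text \<open>The Cauchy property and completeness are obtained in the Frobenius norm; the smaller
  operator norm inherits the convergence.\<close>

lemma L2_tendsto_Hpart:
  fixes alpha :: "int \<Rightarrow> complex^'r^'r"
  assumes A1: "condA1 lam alpha" and pos: "\<And>j. mpos (alpha j)"
  shows "\<exists>H. L2_tendsto {-1<..<1} mnorm (Hpart lam alpha) H"
proof -
  let ?S = "{-1<..<1::real}"
  let ?F = "Hpart lam alpha"
  have fin: "finite (nodes lam k)" for k
    using A1 by (simp add: condA1_def nodes_def)
  note part = Hpart_eq_sum_block[OF fin]
  have contF: "continuous_on T (?F n)" for n T
    unfolding part by (intro continuous_intros continuous_block)
  from condA1_bounds[OF A1 pos] obtain w :: "int \<Rightarrow> real" where w: "w summable_on UNIV" "\<And>k. 0 \<le> w k"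
    "\<And>K. finite K \<Longrightarrow> integral {-1..1} (\<lambda>x. (norm (\<Sum>k\<in>K. block lam alpha k x))\<^sup>2) \<le> sum w K"
    by blast
  have nn: "(\<integral>\<^sup>+x\<in>?S. ennreal ((norm (\<Sum>k\<in>K. block lam alpha k x))\<^sup>2) \<partial>lebesgue) \<le> ennreal (sum w K)"
    if "finite K" for K
    by (rule order_trans[OF set_nn_integral_continuous_le])
       (auto intro!: continuous_intros continuous_block ennreal_leI w(3) that)
  have cauchy: "\<exists>N. \<forall>m\<ge>N. \<forall>n\<ge>N. (\<integral>\<^sup>+x\<in>?S. ennreal ((norm (?F m x - ?F n x))\<^sup>2) \<partial>lebesgue) \<le> ennreal e"
    if e: "0 < e" for e
  proof -
    obtain F where F: "finite F" "\<And>K. finite K \<Longrightarrow> K \<inter> F = {} \<Longrightarrow> sum w K < e"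
      using summable_on_sum_disjoint_small[OF w(1,2) e] by blast
    have "finite (abs ` F)" using F(1) by simp
    then obtain b where b: "\<And>k. k \<in> F \<Longrightarrow> \<bar>k\<bar> \<le> b"
      by (meson bdd_above.E bdd_above_finite image_eqI)
    \<comment> \<open>The range \<open>{1 - int n..int n}\<close> contains [-b, b] only from n = b +
      1 on; blocks added later lie outside F.\<close>
    define N where "N = nat (b + 1)"
    have small: "(\<integral>\<^sup>+x\<in>?S. ennreal ((norm (?F m x - ?F n x))\<^sup>2) \<partial>lebesgue) \<le> ennreal e"
      if mn: "N \<le> n" "n \<le> m" for m n
    proof -
      define K where "K = {1 - int m..int m} - {1 - int n..int n}"
      have "k \<notin> F" if "k \<in> K" for k
        using that mn b[of k] by (auto simp: K_def N_def)
      then have "sum w K < e" by (intro F(2)) (auto simp: K_def)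
      moreover have "?F m x - ?F n x = (\<Sum>k\<in>K. block lam alpha k x)" for x
        unfolding part K_def using mn by (subst sum_diff) auto
      moreover have "finite K" by (simp add: K_def)
      ultimately show ?thesis
        using order_trans[OF nn[of K] ennreal_leI[of "sum w K" e]] by simp
    qed
    have "(\<integral>\<^sup>+x\<in>?S. ennreal ((norm (?F m x - ?F n x))\<^sup>2) \<partial>lebesgue) \<le> ennreal e"
      if "N \<le> m" "N \<le> n" for m n
    proof (cases "n \<le> m")
      case False
      then show ?thesis using small[of m n] that by (simp add: norm_minus_commute)
    qed (use small that in auto)
    then show ?thesis by blast
  qed
  have finF: "(\<integral>\<^sup>+x\<in>?S. ennreal ((norm (?F n x))\<^sup>2) \<partial>lebesgue) < \<infinity>" for n
    unfolding part using nn[of "{1 - int n..int n}"] by (auto intro: le_less_trans)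
  have measF: "?F n \<in> borel_measurable (lebesgue_on ?S)" for n
    by (rule continuous_imp_measurable_on_sets_lebesgue[OF contF]) simp
  obtain H where H: "H \<in> borel_measurable (lebesgue_on ?S)"
    and lim: "(\<lambda>n. \<integral>\<^sup>+x\<in>?S. ennreal ((norm (?F n x - H x))\<^sup>2) \<partial>lebesgue) \<longlonglongrightarrow> 0"
    by (rule L2_complete_lebesgue[of ?S ?F]) (use measF finF cauchy in auto)
  have mle: "(\<integral>\<^sup>+x\<in>?S. ennreal ((mnorm (G x))\<^sup>2) \<partial>lebesgue) \<le> (\<integral>\<^sup>+x\<in>?S. ennreal ((norm (G x))\<^sup>2) \<partial>lebesgue)"
    for G :: "real \<Rightarrow> complex^'r^'r"
    by (intro nn_integral_mono mult_right_mono ennreal_leI power_mono mnorm_le_norm mnorm_nonneg) auto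
  have "(\<lambda>n. \<integral>\<^sup>+x\<in>?S. ennreal ((mnorm (?F n x - H x))\<^sup>2) \<partial>lebesgue) \<longlonglongrightarrow> 0"
    by (rule tendsto_sandwich[OF _ _ tendsto_const lim]) (auto intro!: always_eventually mle)
  moreover have "sq_int ?S mnorm H"
  proof -
    \<comment> \<open>One partial sum at finite distance from H is enough to make H itself square
      integrable.\<close>
    from order_tendstoD(2)[OF lim, of 1] obtain n
      where n: "(\<integral>\<^sup>+x\<in>?S. ennreal ((norm (?F n x - H x))\<^sup>2) \<partial>lebesgue) < 1"
      by (auto simp: eventually_sequentially)
    have eq: "(\<integral>\<^sup>+x\<in>?S. g x \<partial>lebesgue) = (\<integral>\<^sup>+x. g x \<partial>lebesgue_on ?S)" for g
      by (subst nn_integral_restrict_space) auto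
    note [measurable] = H measF
    have "(\<integral>\<^sup>+x\<in>?S. ennreal ((norm (H x))\<^sup>2) \<partial>lebesgue)
      \<le> (\<integral>\<^sup>+x. 2 * ennreal ((norm (?F n x))\<^sup>2) + 2 * ennreal ((norm (?F n x - H x))\<^sup>2) \<partial>lebesgue_on ?S)"
      unfolding eq
    proof (rule nn_integral_mono)
      fix x
      have "(norm (H x))\<^sup>2 \<le> 2 * (norm (?F n x))\<^sup>2 + 2 * (norm (?F n x - H x))\<^sup>2"
        using norm_add_sq_le[of "?F n x" "H x - ?F n x"] by (simp add: norm_minus_commute)
      then have "ennreal ((norm (H x))\<^sup>2) \<le> ennreal (2 * (norm (?F n x))\<^sup>2 + 2 * (norm (?F n x - H x))\<^sup>2)"
        by (rule ennreal_leI)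
      then show "ennreal ((norm (H x))\<^sup>2) \<le> 2 * ennreal ((norm (?F n x))\<^sup>2) + 2 * ennreal ((norm (?F n x - H x))\<^sup>2)"
        by (simp add: ennreal_plus ennreal_mult)
    qed
    also have "\<dots> = 2 * (\<integral>\<^sup>+x. ennreal ((norm (?F n x))\<^sup>2) \<partial>lebesgue_on ?S)
       + 2 * (\<integral>\<^sup>+x. ennreal ((norm (?F n x - H x))\<^sup>2) \<partial>lebesgue_on ?S)"
      by (subst nn_integral_add) (auto simp: nn_integral_cmult)
    also have "\<dots> < \<infinity>"
      using finF[of n] n unfolding eq by (auto simp: ennreal_mult_less_top intro: less_trans)
    finally show ?thesis
      using mle[of H] H by (subst sq_int_mnorm_iff) (auto intro: le_less_trans)
  qed
  ultimately show ?thesis unfolding L2_tendsto_def by blast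
qed

section \<open>Fourier transform and convolution\<close>

text \<open>The 2 in the exponent matches the kernel e^{2i \<lambda> x}. At pi k the values are the
  Fourier coefficients on (0,1), and after t = (1 + s)/2 the exponentials become, up to a phase,
  those of (A3) on (-1,1).\<close>

definition fourier :: "(real \<Rightarrow> complex^'r) \<Rightarrow> real \<Rightarrow> complex^'r" where
  "fourier u l = (\<integral>t. cis (- 2 * l * t) *s u t \<partial>lebesgue)"

lemma mscale_vector_mult: "mscale c A *v v = c *s (A *v v)"
  by (simp add: vec_eq_iff matrix_vector_mult_def sum_distrib_left mult_ac)

lemma bounded_linear_smult: "bounded_linear (\<lambda>v::complex^'n. c *s v)"
proof -
  have "(\<lambda>v::complex^'n. c *s v) = (*v) (mscale c (mat 1))"
    by (simp add: mscale_vector_mult fun_eq_iff)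
  then show ?thesis by simp
qed

lemma matrix_vector_smult: "A *v (c *s v) = c *s (A *v v)" for A :: "complex^'n^'m"
  by (simp add: vec_eq_iff matrix_vector_mult_def sum_distrib_left mult_ac)

lemma inner_smult: "inner (c *s w) v = inner w (cnj c *s v)" for w v :: "complex^'n"
  by (simp add: inner_cvec mult_ac)

lemma norm_smult: "norm (c *s v) = norm c * norm v" for v :: "complex^'n"
  by (simp add: norm_vec_def norm_mult L2_set_right_distrib)

lemma borel_measurable_matrix_vector [measurable (raw)]:
  fixes A :: "'b \<Rightarrow> complex^'n^'m"
  assumes "A \<in> borel_measurable M" "v \<in> borel_measurable M"
  shows "(\<lambda>x. A x *v v x) \<in> borel_measurable M"
proof (rule borel_measurable_continuous_Pair[OF assms])
  show "continuous_on UNIV (\<lambda>x::(complex^'n^'m) \<times> (complex^'n). fst x *v snd x)"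
    unfolding matrix_vector_mult_def by (intro continuous_on_vec_lambda continuous_intros)
qed

lemma borel_measurable_smult [measurable (raw)]:
  fixes v :: "'b \<Rightarrow> complex^'n"
  assumes "c \<in> borel_measurable M" "v \<in> borel_measurable M"
  shows "(\<lambda>x. c x *s v x) \<in> borel_measurable M"
proof (rule borel_measurable_continuous_Pair[OF assms])
  show "continuous_on UNIV (\<lambda>x::complex \<times> (complex^'n). fst x *s snd x)"
    unfolding vector_scalar_mult_def by (intro continuous_on_vec_lambda continuous_intros)
qed

lemma continuous_imp_borel_measurable_lebesgue:
  "continuous_on UNIV f \<Longrightarrow> f \<in> borel_measurable lebesgue" for f :: "real \<Rightarrow> 'b::euclidean_space"
  using continuous_imp_measurable_on_sets_lebesgue[of UNIV f] by (simp add: lebesgue_on_UNIV_eq)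

lemma integrable_cis_smult:
  assumes "integrable lebesgue u"
  shows "integrable lebesgue (\<lambda>t. cis (c * t) *s u t)"
proof (rule Bochner_Integration.integrable_bound[OF assms])
  have [measurable]: "u \<in> borel_measurable lebesgue" using assms by auto
  have [measurable]: "(\<lambda>t. cis (c * t)) \<in> borel_measurable lebesgue"
    by (intro continuous_imp_borel_measurable_lebesgue continuous_cis continuous_intros)
  show "(\<lambda>t. cis (c * t) *s u t) \<in> borel_measurable lebesgue" by measurable
qed (simp add: norm_smult)

text \<open>The inner product conjugates one factor, so moving the exponential across it produces
  the kernel of \<open>fourier\<close>.\<close>

lemma
  assumes "integrable lebesgue u"
  shows integrable_inner_cis: "integrable lebesgue (\<lambda>t. inner (cis (2 * l * t) *s w) (u t))"
    and integral_inner_cis: "(\<integral>t. inner (cis (2 * l * t) *s w) (u t) \<partial>lebesgue) = inner w (fourier u l)"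
proof -
  have int: "integrable lebesgue (\<lambda>t. cis (- 2 * l * t) *s u t)"
    using integrable_cis_smult[OF assms, of "- 2 * l"] by simp
  have eq: "inner (cis (2 * l * t) *s w) (u t) = inner w (cis (- 2 * l * t) *s u t)" for t
    by (simp add: inner_smult cis_cnj)
  show "integrable lebesgue (\<lambda>t. inner (cis (2 * l * t) *s w) (u t))"
    unfolding eq by (intro integrable_inner_right int)
  show "(\<integral>t. inner (cis (2 * l * t) *s w) (u t) \<partial>lebesgue) = inner w (fourier u l)"
    unfolding eq fourier_def by (intro integral_inner_right int)
qed

lemma norm_sq_cvec: "(norm v)\<^sup>2 = (\<Sum>i\<in>UNIV. (norm (v $ i))\<^sup>2)" for v :: "complex^'n"
  by (simp add: norm_vec_def L2_set_def sum_nonneg)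

text \<open>With p the Fourier partial sum, both the pairing of p with u and the squared norm of p
  on [0,1] equal B, so nonnegativity of |u - p|^2 integrates to B \<le> |u|^2. Parseval is applied
  in each coordinate.\<close>

lemma bessel:
  fixes u :: "real \<Rightarrow> complex^'r"
  assumes u: "integrable lebesgue u" and u2: "integrable lebesgue (\<lambda>t. (norm (u t))\<^sup>2)"
    and supp: "\<And>t. t \<notin> {0..1} \<Longrightarrow> u t = 0" and K: "finite K"
  shows "(\<Sum>k\<in>K. (norm (fourier u (pi * real_of_int k)))\<^sup>2) \<le> (\<integral>t. (norm (u t))\<^sup>2 \<partial>lebesgue)"
proof -
  define b where "b k = fourier u (pi * real_of_int k)" for k
  define p where "p x = (\<Sum>k\<in>K. cis (2 * (pi * real_of_int k) * x) *s b k)" for x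
  define B where "B = (\<Sum>k\<in>K. (norm (b k))\<^sup>2)"
  have pu: "inner (p x) (u x) = (\<Sum>k\<in>K. inner (cis (2 * (pi * real_of_int k) * x) *s b k) (u x))" for x
    by (simp add: p_def inner_sum_left)
  have pu_int: "integrable lebesgue (\<lambda>x. inner (p x) (u x))"
    unfolding pu by (intro Bochner_Integration.integrable_sum integrable_inner_cis u)
  have "(\<integral>x. inner (p x) (u x) \<partial>lebesgue) = (\<Sum>k\<in>K. inner (b k) (b k))"
    unfolding pu by (subst Bochner_Integration.integral_sum)
      (auto intro!: integrable_inner_cis[OF u] simp: integral_inner_cis[OF u] b_def)
  then have pu_eq: "(\<integral>x. inner (p x) (u x) \<partial>lebesgue) = B"
    by (simp add: B_def power2_norm_eq_inner)
  have contp: "continuous_on S (\<lambda>x. p x $ i)" for S i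
    unfolding p_def sum_component vector_smult_component by (intro continuous_intros continuous_cis)
  have contp2: "continuous_on {0..1} (\<lambda>x. (norm (p x))\<^sup>2)"
    unfolding norm_sq_cvec by (intro continuous_intros contp)
  have "((\<lambda>x. \<Sum>i\<in>UNIV. (norm (\<Sum>k\<in>K. b k $ i * cis (2 * pi * real_of_int k * x)))\<^sup>2) has_integral
      (\<Sum>i\<in>UNIV. of_int (1 - 0) * (\<Sum>k\<in>K. (norm (b k $ i))\<^sup>2))) {real_of_int 0..real_of_int 1}"
    by (intro has_integral_sum has_integral_norm_sq_trig_poly K) auto
  also have "(\<lambda>x. \<Sum>i\<in>UNIV. (norm (\<Sum>k\<in>K. b k $ i * cis (2 * pi * real_of_int k * x)))\<^sup>2) = (\<lambda>x. (norm (p x))\<^sup>2)"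
    by (simp add: norm_sq_cvec p_def mult_ac)
  also have "(\<Sum>i\<in>UNIV. of_int (1 - 0) * (\<Sum>k\<in>K. (norm (b k $ i))\<^sup>2)) = B"
    unfolding B_def norm_sq_cvec by (simp add: sum.swap[of _ K])
  finally have p2: "((\<lambda>x. (norm (p x))\<^sup>2) has_integral B) {0..1}" by simp
  have p2_int: "integrable lebesgue (\<lambda>x. indicator {0..1} x * (norm (p x))\<^sup>2)"
    using absolutely_integrable_continuous_real[OF contp2] by (simp add: set_integrable_def)
  have p2_eq: "(\<integral>x. indicator {0..1} x * (norm (p x))\<^sup>2 \<partial>lebesgue) = B"
    using set_lebesgue_integral_eq_integral(2)[OF absolutely_integrable_continuous_real[OF contp2]]
      integral_unique[OF p2]
    by (simp add: set_lebesgue_integral_def)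
  \<comment> \<open>p is periodic and does not vanish outside [0,1]; the indicator truncates it
    there, while the other two terms vanish with u.\<close>
  have "0 \<le> (\<integral>x. (norm (u x))\<^sup>2 - 2 * inner (p x) (u x) + indicator {0..1} x * (norm (p x))\<^sup>2 \<partial>lebesgue)"
  proof (rule Bochner_Integration.integral_nonneg)
    fix x
    show "0 \<le> (norm (u x))\<^sup>2 - 2 * inner (p x) (u x) + indicator {0..1} x * (norm (p x))\<^sup>2"
    proof (cases "x \<in> {0..1}")
      case True
      have "0 \<le> (norm (u x - p x))\<^sup>2" by simp
      also have "\<dots> = (norm (u x))\<^sup>2 - 2 * inner (p x) (u x) + (norm (p x))\<^sup>2"
        by (simp add: power2_norm_eq_inner inner_diff_left inner_diff_right inner_commute)
      finally show ?thesis using True by simp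
    qed (simp add: supp)
  qed
  also have "\<dots> = (\<integral>x. (norm (u x))\<^sup>2 \<partial>lebesgue) - 2 * B + B"
    using u2 pu_int p2_int by (simp add: pu_eq p2_eq)
  finally show ?thesis by (simp add: B_def b_def)
qed

text \<open>Lebesgue measurability does not survive composition with arbitrary Borel maps; affine
  maps of nonzero slope pull null sets back to null sets. Reflection and rescaling of H and u depend
  on this.\<close>

lemma measurable_lebesgue_affine:
  "c \<noteq> 0 \<Longrightarrow> (\<lambda>x::real. t + c * x) \<in> lebesgue \<rightarrow>\<^sub>M lebesgue"
  using lebesgue_affine_measurable[where c="\<lambda>x::real. c"] by simp

lemma measurable_lebesgue_reflect: "(\<lambda>t::real. x - t) \<in> lebesgue \<rightarrow>\<^sub>M lebesgue"
  using measurable_lebesgue_affine[of "-1" x] by simp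

text \<open>The bound does not involve x, because reflection and translation preserve Lebesgue
  measure. Applied to the difference of H and a partial sum, it converts L_2 convergence of kernels
  into uniform convergence of convolutions.\<close>

lemma convolution_bound:
  fixes D :: "real \<Rightarrow> complex^'r^'r"
  assumes D: "D \<in> borel_measurable lebesgue" and u[measurable]: "u \<in> borel_measurable lebesgue"
  shows "(\<lambda>t. D (x - t) *v u t) \<in> borel_measurable lebesgue"
    and "(\<integral>\<^sup>+t. ennreal (norm (D (x - t) *v u t)) \<partial>lebesgue)\<^sup>2 \<le>
      (\<integral>\<^sup>+s. ennreal ((mnorm (D s))\<^sup>2) \<partial>lebesgue) * (\<integral>\<^sup>+t. ennreal ((norm (u t))\<^sup>2) \<partial>lebesgue)"
proof -
  have [measurable]: "(\<lambda>t. D (x - t)) \<in> borel_measurable lebesgue"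
    using measurable_compose[OF measurable_lebesgue_reflect D] .
  show "(\<lambda>t. D (x - t) *v u t) \<in> borel_measurable lebesgue" by measurable
  have "(\<integral>\<^sup>+t. ennreal (norm (D (x - t) *v u t)) \<partial>lebesgue) \<le>
     (\<integral>\<^sup>+t. ennreal (mnorm (D (x - t))) * ennreal (norm (u t)) \<partial>lebesgue)"
    by (intro nn_integral_mono) (simp flip: ennreal_mult add: mnorm_nonneg norm_matrix_vector_le_mnorm)
  then have "(\<integral>\<^sup>+t. ennreal (norm (D (x - t) *v u t)) \<partial>lebesgue)\<^sup>2 \<le>
     (\<integral>\<^sup>+t. ennreal (mnorm (D (x - t))) * ennreal (norm (u t)) \<partial>lebesgue)\<^sup>2"
    by (intro power_mono) auto
  also have "\<dots> \<le> (\<integral>\<^sup>+t. (ennreal (mnorm (D (x - t))))\<^sup>2 \<partial>lebesgue) * (\<integral>\<^sup>+t. (ennreal (norm (u t)))\<^sup>2 \<partial>lebesgue)"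
    by (rule Cauchy_Schwarz_nn_integral) measurable
  also have "(\<integral>\<^sup>+t. (ennreal (mnorm (D (x - t))))\<^sup>2 \<partial>lebesgue) = (\<integral>\<^sup>+s. ennreal ((mnorm (D s))\<^sup>2) \<partial>lebesgue)"
    using nn_integral_real_affine_lebesgue[of "\<lambda>s. ennreal ((mnorm (D s))\<^sup>2)" "-1" x] D
    by (simp add: ennreal_power mnorm_nonneg)
  finally show "(\<integral>\<^sup>+t. ennreal (norm (D (x - t) *v u t)) \<partial>lebesgue)\<^sup>2 \<le>
      (\<integral>\<^sup>+s. ennreal ((mnorm (D s))\<^sup>2) \<partial>lebesgue) * (\<integral>\<^sup>+t. ennreal ((norm (u t))\<^sup>2) \<partial>lebesgue)"
    by (simp add: ennreal_power)
qed

lemma matrix_vector_mult_sum_left: "(\<Sum>i\<in>I. A i) *v v = (\<Sum>i\<in>I. A i *v v)"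
  for A :: "'b \<Rightarrow> complex^'n^'m"
  by (simp add: vec_eq_iff matrix_vector_mult_def sum_distrib_right sum.swap[of _ I])

text \<open>Each exponential of x - t factors into one in x and one in t, so the convolution is a
  finite trigonometric sum whose coefficients are values of the transform of u.\<close>

lemma
  fixes u :: "real \<Rightarrow> complex^'r"
  assumes fin: "\<And>k. finite (nodes lam k)" and u: "integrable lebesgue u"
  shows integrable_block_convolution: "integrable lebesgue (\<lambda>t. block lam alpha k (x - t) *v u t)"
    and integral_block_convolution: "(\<integral>t. block lam alpha k (x - t) *v u t \<partial>lebesgue) =
      (\<Sum>j\<in>nodes lam k. cis (2 * lam j * x) *s (alpha j *v fourier u (lam j)))
      - cis (2 * (pi * real_of_int k) * x) *s fourier u (pi * real_of_int k)"
proof -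
  have int: "integrable lebesgue (\<lambda>t. cis (- 2 * l * t) *s u t)" for l
    using integrable_cis_smult[OF u, of "- 2 * l"] by simp
  have cis: "cis (2 * l * (x - t)) = cis (2 * l * x) * cis (- 2 * l * t)" for l t
    by (simp add: cis_mult algebra_simps)
  have eq: "block lam alpha k (x - t) *v u t =
      (\<Sum>j\<in>nodes lam k. cis (2 * lam j * x) *s (alpha j *v (cis (- 2 * lam j * t) *s u t)))
      - cis (2 * (pi * real_of_int k) * x) *s (cis (- 2 * (pi * real_of_int k) * t) *s u t)" for t
    unfolding block_def matrix_vector_mult_diff_rdistrib matrix_vector_mult_sum_left mscale_vector_mult
      matrix_vector_smult mult.assoc[of 2 pi] cis by simp
  have i1: "integrable lebesgue (\<lambda>t. cis (2 * lam j * x) *s (alpha j *v (cis (- 2 * lam j * t) *s u t)))" for j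
    by (intro integrable_bounded_linear[OF bounded_linear_smult]
        integrable_bounded_linear[OF matrix_vector_mul_bounded_linear] int)
  have e1: "(\<integral>t. cis (2 * lam j * x) *s (alpha j *v (cis (- 2 * lam j * t) *s u t)) \<partial>lebesgue)
      = cis (2 * lam j * x) *s (alpha j *v fourier u (lam j))" for j
    unfolding fourier_def
    by (subst integral_bounded_linear[OF bounded_linear_smult]
        integral_bounded_linear[OF matrix_vector_mul_bounded_linear],
        intro integrable_bounded_linear[OF matrix_vector_mul_bounded_linear] int)+ simp
  have i2: "integrable lebesgue (\<lambda>t. cis c *s (cis (- 2 * l * t) *s u t))" for c l
    by (intro integrable_bounded_linear[OF bounded_linear_smult] int)
  have e2: "(\<integral>t. cis c *s (cis (- 2 * l * t) *s u t) \<partial>lebesgue) = cis c *s fourier u l" for c l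
    unfolding fourier_def by (intro integral_bounded_linear[OF bounded_linear_smult] int)
  show "integrable lebesgue (\<lambda>t. block lam alpha k (x - t) *v u t)"
    unfolding eq by (intro Bochner_Integration.integrable_diff Bochner_Integration.integrable_sum i1 i2)
  show "(\<integral>t. block lam alpha k (x - t) *v u t \<partial>lebesgue) =
      (\<Sum>j\<in>nodes lam k. cis (2 * lam j * x) *s (alpha j *v fourier u (lam j)))
      - cis (2 * (pi * real_of_int k) * x) *s fourier u (pi * real_of_int k)"
    unfolding eq
    by (subst Bochner_Integration.integral_diff)
       (auto intro!: i1 i2 Bochner_Integration.integrable_sum
         simp only: Bochner_Integration.integral_sum[OF i1] e1 e2)
qed

section \<open>The accelerant property\<close>

text \<open>Carries a bound on a nonnegative majorant over to a signed integrand; the finite bound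
  itself makes the majorant integrable.\<close>

lemma integral_le_nn_integral:
  fixes u v :: "'b \<Rightarrow> real"
  assumes u: "integrable M u" and v: "v \<in> borel_measurable M" and le: "\<And>x. u x \<le> v x" "\<And>x. 0 \<le> v x"
    and bound: "(\<integral>\<^sup>+x. ennreal (v x) \<partial>M) \<le> ennreal e" and e: "0 \<le> e"
  shows "(\<integral>x. u x \<partial>M) \<le> e"
proof -
  have int: "integrable M v"
    unfolding integrable_iff_bounded using v le bound by (auto intro: le_less_trans)
  have "(\<integral>x. u x \<partial>M) \<le> (\<integral>x. v x \<partial>M)"
    by (intro integral_mono u int le)
  also have "\<dots> \<le> e"
    using bound nn_integral_eq_integral[OF int] le e by simp
  finally show ?thesis .
qed

text \<open>If q approximates u within e in squared norm and is orthogonal to u, then expanding |u -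
  q|^2 and dropping |q|^2 leaves |u|^2 \<le> e. The approximants come from (A3) after u is stretched
  from (0,1) to (-1,1).\<close>

lemma complete_orthogonal_imp_zero:
  fixes u :: "real \<Rightarrow> complex^'r"
  assumes A3: "condA3 lam alpha" and pos: "\<And>j. mpos (alpha j)"
    and u: "integrable lebesgue u" and u2: "integrable lebesgue (\<lambda>t. (norm (u t))\<^sup>2)"
    and supp: "\<And>t. t \<notin> {0<..<1} \<Longrightarrow> u t = 0"
    and orth: "\<And>j. alpha j *v fourier u (lam j) = 0"
  shows "AE t in lebesgue. u t = 0"
proof -
  have meas: "u \<in> borel_measurable lebesgue" using u by auto
  define g where "g s = u (1/2 + 1/2 * s)" for s
  have g_meas: "g \<in> borel_measurable lebesgue"
    unfolding g_def using measurable_compose[OF measurable_lebesgue_affine meas, of "1/2" "1/2"] by simp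
  have g_supp: "g s = 0" if "s \<notin> {-1<..<1}" for s
    unfolding g_def using that by (intro supp) auto
  have "sq_int {-1<..<1} norm g"
    unfolding sq_int_def
  proof
    have "indicator {-1<..<1} s *\<^sub>R g s = g s" for s using g_supp by (auto simp: indicator_def)
    then show "set_borel_measurable lebesgue {-1<..<1} g"
      using g_meas by (simp add: set_borel_measurable_def)
    have "integrable lebesgue (\<lambda>s. (norm (g s))\<^sup>2)"
      unfolding g_def using lebesgue_integrable_real_affine[OF u2, of "1/2" "1/2"] by simp
    moreover have "(\<integral>\<^sup>+s\<in>{-1<..<1}. ennreal ((norm (g s))\<^sup>2) \<partial>lebesgue) \<le> (\<integral>\<^sup>+s. ennreal ((norm (g s))\<^sup>2) \<partial>lebesgue)"
      by (intro nn_integral_mono) (auto simp: indicator_def)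
    ultimately show "(\<integral>\<^sup>+s\<in>{-1<..<1}. ennreal ((norm (g s))\<^sup>2) \<partial>lebesgue) < \<infinity>"
      by (auto simp: nn_integral_eq_integral intro: le_less_trans)
  qed
  note approx = A3[unfolded condA3_def, THEN spec, THEN mp, OF this, THEN spec, THEN mp]
  have "(\<integral>t. (norm (u t))\<^sup>2 \<partial>lebesgue) \<le> 0 + e" if e: "0 < e" for e
  proof -
    obtain Fs c where Fs: "finite Fs" and ran: "\<forall>(j,d)\<in>Fs. d \<in> range (\<lambda>v. alpha j *v v)"
      and small: "(\<integral>\<^sup>+t\<in>{-1<..<1}. ennreal ((norm (g t -
              (\<Sum>(j,d)\<in>Fs. (c (j,d) * exp (\<i> * complex_of_real (lam j * t))) *s d)))^2) \<partial>lebesgue) < ennreal e"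
      using approx[OF e] by (elim exE conjE)
    define P where "P t = (\<Sum>(j,d)\<in>Fs. (c (j,d) * exp (\<i> * complex_of_real (lam j * t))) *s d)" for t
    define q where "q t = P (-1 + 2 * t)" for t
    \<comment> \<open>The shift in s = 2t - 1 leaves the constant phase e^{-i \<lambda>}, which is
      absorbed into the coefficient.\<close>
    define w where "w z = (c z * cis (- lam (fst z))) *s snd z" for z
    have q: "q t = (\<Sum>z\<in>Fs. cis (2 * lam (fst z) * t) *s w z)" for t
    proof -
      have "cis (lam j * (-1 + 2 * t)) = cis (2 * lam j * t) * cis (- lam j)" for j
        by (simp add: cis_mult algebra_simps)
      then show ?thesis
        unfolding q_def P_def w_def cis_conv_exp[symmetric]
        by (intro sum.cong) (auto simp: mult_ac)
    qed
    have wz: "inner (w z) (fourier u (lam (fst z))) = 0" if z: "z \<in> Fs" for z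
    proof -
      obtain v where "snd z = alpha (fst z) *v v"
        using bspec[OF ran z] by (auto simp: case_prod_beta)
      \<comment> \<open>Complex scalars commute with the matrix, so the coefficient stays in the
        range of \<open>alpha (fst z)\<close>; self-adjointness then moves that matrix onto the
        transform, where \<open>orth\<close> applies.\<close>
      then have "w z = alpha (fst z) *v ((c z * cis (- lam (fst z))) *s v)"
        by (simp add: w_def matrix_vector_smult)
      then show ?thesis
        using mpos_selfadjoint[OF pos] orth by simp
    qed
    have qu: "inner (q t) (u t) = (\<Sum>z\<in>Fs. inner (cis (2 * lam (fst z) * t) *s w z) (u t))" for t
      by (simp add: q inner_sum_left)
    have qu_int: "integrable lebesgue (\<lambda>t. inner (q t) (u t))"
      unfolding qu by (intro Bochner_Integration.integrable_sum integrable_inner_cis u)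
    have qu_eq: "(\<integral>t. inner (q t) (u t) \<partial>lebesgue) = 0"
      unfolding qu by (subst Bochner_Integration.integral_sum)
        (auto intro!: integrable_inner_cis[OF u] simp: integral_inner_cis[OF u] wz)
    have contq: "continuous_on UNIV q"
    proof -
      have "continuous_on UNIV (\<lambda>t. \<chi> i. q t $ i)"
        unfolding q sum_component vector_smult_component
        by (intro continuous_on_vec_lambda continuous_intros continuous_cis)
      then show ?thesis by simp
    qed
    have contP: "continuous_on UNIV P"
    proof -
      have "P = (\<lambda>s. q (1/2 + 1/2 * s))" by (simp add: q_def fun_eq_iff)
      then show ?thesis by (auto intro!: continuous_intros continuous_on_compose2[OF contq])
    qed
    note [measurable] = meas g_meas continuous_imp_borel_measurable_lebesgue[OF contq]
      continuous_imp_borel_measurable_lebesgue[OF contP]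
    have m: "(\<lambda>s. ennreal ((norm (g s - P s))\<^sup>2) * indicator {-1<..<1} s) \<in> borel_measurable lebesgue"
      by (intro borel_measurable_times_ennreal borel_measurable_indicator) auto
    have "(\<integral>\<^sup>+t\<in>{-1<..<1}. ennreal ((norm (g t - P t))\<^sup>2) \<partial>lebesgue) =
       2 * (\<integral>\<^sup>+t. ennreal ((norm (g (-1 + 2 * t) - P (-1 + 2 * t)))\<^sup>2) * indicator {-1<..<1} (-1 + 2 * t) \<partial>lebesgue)"
      using nn_integral_real_affine_lebesgue[OF m, of 2 "-1"] by simp
    also have "\<dots> = 2 * (\<integral>\<^sup>+t. ennreal (indicator {0<..<1} t * (norm (u t - q t))\<^sup>2) \<partial>lebesgue)"
      by (intro arg_cong[where f="\<lambda>x. 2 * x"] nn_integral_cong)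
         (auto simp: g_def q_def indicator_def algebra_simps)
    finally have "2 * (\<integral>\<^sup>+t. ennreal (indicator {0<..<1} t * (norm (u t - q t))\<^sup>2) \<partial>lebesgue) < ennreal e"
      using small unfolding P_def by simp
    \<comment> \<open>The factor 2 is the Jacobian of t -> 2t - 1; discarding it preserves the bound
      e.\<close>
    moreover have "x \<le> 2 * x" for x :: ennreal
      using mult_right_mono[of 1 2 x] by simp
    ultimately have le: "(\<integral>\<^sup>+t. ennreal (indicator {0<..<1} t * (norm (u t - q t))\<^sup>2) \<partial>lebesgue) \<le> ennreal e"
      by (meson le_less_trans less_imp_le)
    have "(\<integral>t. (norm (u t))\<^sup>2 - 2 * inner (q t) (u t) \<partial>lebesgue) \<le> e"
    proof (rule integral_le_nn_integral[OF _ _ _ _ le])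
      show "integrable lebesgue (\<lambda>t. (norm (u t))\<^sup>2 - 2 * inner (q t) (u t))"
        using u2 qu_int by simp
      show "(\<lambda>t. indicator {0<..<1} t * (norm (u t - q t))\<^sup>2) \<in> borel_measurable lebesgue"
        by (intro borel_measurable_times borel_measurable_indicator) auto
      show "(norm (u t))\<^sup>2 - 2 * inner (q t) (u t) \<le> indicator {0<..<1} t * (norm (u t - q t))\<^sup>2" for t
      proof (cases "t \<in> {0<..<1}")
        case True
        have "(norm (u t - q t))\<^sup>2 = (norm (u t))\<^sup>2 - 2 * inner (q t) (u t) + (norm (q t))\<^sup>2"
          by (simp add: power2_norm_eq_inner inner_diff_left inner_diff_right inner_commute)
        then show ?thesis using True by simp
      qed (simp add: supp)
    qed (use e in auto)
    then show ?thesis using u2 qu_int by (simp add: qu_eq)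
  qed
  then have "(\<integral>t. (norm (u t))\<^sup>2 \<partial>lebesgue) \<le> 0"
    by (rule field_le_epsilon)
  moreover have "0 \<le> (\<integral>t. (norm (u t))\<^sup>2 \<partial>lebesgue)" by simp
  ultimately have "(\<integral>t. (norm (u t))\<^sup>2 \<partial>lebesgue) = 0" by linarith
  then show ?thesis
    using integral_nonneg_eq_0_iff_AE[OF u2] by simp
qed

section \<open>Hermitian symmetry of the limit\<close>

lemma norm_cadj: "norm (cadj A) = norm A"
proof -
  have "(norm (cadj A))\<^sup>2 = (norm A)\<^sup>2"
    unfolding norm_sq_matrix cadj_def by (simp add: sum.swap[of "\<lambda>i j. (norm (A $ j $ i))\<^sup>2"])
  then show ?thesis by simp
qed

lemma cadj_diff: "cadj (A - B) = cadj A - cadj B"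
  by (simp add: cadj_def vec_eq_iff)

text \<open>Frequencies are real and the \<open>alpha j\<close> Hermitian, so the adjoint merely
  conjugates the exponentials, which is the reflection x -> -x.\<close>

lemma cadj_Hpart:
  assumes fin: "\<And>k. finite (nodes lam k)" and pos: "\<And>j. mpos (alpha j)"
  shows "cadj (Hpart lam alpha n x) = Hpart lam alpha n (- x)"
proof -
  have adj: "cnj (alpha j $ q $ p) = alpha j $ p $ q" for j p q
    using pos[of j] by (auto simp: mpos_def cadj_def vec_eq_iff)
  have one: "cnj (mat 1 $ q $ p) = mat 1 $ p $ q" for p q :: 'a
    by (simp add: mat_def)
  have "cnj (block lam alpha k x $ q $ p) = block lam alpha k (- x) $ p $ q" for k p q
    unfolding block_def vector_minus_component sum_component mscale_nth complex_cnj_diff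
      complex_cnj_mult cnj_sum adj one cis_cnj by simp
  then show ?thesis
    unfolding Hpart_eq_sum_block[OF fin] by (simp add: cadj_def vec_eq_iff)
qed

lemma borel_measurable_cadj [measurable]: "cadj \<in> borel_measurable borel"
  unfolding cadj_def
  by (intro borel_measurable_continuous_onI continuous_on_vec_lambda continuous_intros)

text \<open>Extension by zero: nothing is known about H outside (-1,1), while reflections and
  convolutions are taken over the whole line.\<close>

definition cut :: "(real \<Rightarrow> 'a::real_normed_vector) \<Rightarrow> real \<Rightarrow> 'a" where
  "cut G x = indicator {-1<..<1} x *\<^sub>R G x"

text \<open>Adjoint and reflection preserve the L_2 norm and agree on every partial sum, so the
  symmetry defect of H is at most a constant times its distance to the n-th one.\<close>

lemma L2_limit_symmetric:
  fixes alpha :: "int \<Rightarrow> complex^'r^'r"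
  assumes fin: "\<And>k. finite (nodes lam k)" and pos: "\<And>j. mpos (alpha j)"
    and H: "cut H \<in> borel_measurable lebesgue"
    and G: "\<And>n. cut (Hpart lam alpha n) \<in> borel_measurable lebesgue"
    and lim: "(\<lambda>n. \<integral>\<^sup>+x. ennreal ((mnorm (cut H x - cut (Hpart lam alpha n) x))\<^sup>2) \<partial>lebesgue) \<longlonglongrightarrow> 0"
  shows "AE x in lebesgue. x \<in> {-1<..<1} \<longrightarrow> cadj (H x) = H (- x)"
proof -
  let ?G = "\<lambda>n. cut (Hpart lam alpha n)"
  let ?d = "\<lambda>n. \<integral>\<^sup>+x. ennreal ((mnorm (cut H x - ?G n x))\<^sup>2) \<partial>lebesgue"
  let ?R = "\<integral>\<^sup>+x. ennreal ((norm (cadj (cut H x) - cut H (- x)))\<^sup>2) \<partial>lebesgue"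
  note [measurable] = H G
  have reflect: "(\<lambda>x::real. - x) \<in> lebesgue \<rightarrow>\<^sub>M lebesgue"
    using measurable_lebesgue_reflect[of 0] by simp
  note [measurable] = measurable_compose[OF reflect H] measurable_compose[OF reflect G]
  \<comment> \<open>2 comes from \<open>norm_add_sq_le\<close>, the squared dimension from passing
    from the Frobenius to the operator norm.\<close>
  define r where "r = ennreal (2 * (real CARD('r))\<^sup>2)"
  have symG: "cadj (?G n x) = ?G n (- x)" for n x
    using cadj_Hpart[OF fin pos, where n=n and x=x]
    by (auto simp: cut_def indicator_def cadj_def vec_eq_iff)
  have "?R \<le> 2 * (r * ?d n)" for n
  proof -
    have "?R \<le> (\<integral>\<^sup>+x. r * ennreal ((mnorm (cut H x - ?G n x))\<^sup>2) +
        r * ennreal ((mnorm (cut H (- x) - ?G n (- x)))\<^sup>2) \<partial>lebesgue)"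
    proof (rule nn_integral_mono)
      fix x
      have "(norm (cadj (cut H x) - cut H (- x)))\<^sup>2 =
          (norm (cadj (cut H x - ?G n x) + (?G n (- x) - cut H (- x))))\<^sup>2"
        by (simp add: cadj_diff symG)
      also have "\<dots> \<le> 2 * (norm (cut H x - ?G n x))\<^sup>2 + 2 * (norm (cut H (- x) - ?G n (- x)))\<^sup>2"
        using norm_add_sq_le[of "cadj (cut H x - ?G n x)" "?G n (- x) - cut H (- x)"]
        by (simp add: norm_cadj norm_minus_commute)
      also have "\<dots> \<le> 2 * (real CARD('r))\<^sup>2 * (mnorm (cut H x - ?G n x))\<^sup>2 +
          2 * (real CARD('r))\<^sup>2 * (mnorm (cut H (- x) - ?G n (- x)))\<^sup>2"
        using norm_sq_le_mnorm_sq[of "cut H x - ?G n x"] norm_sq_le_mnorm_sq[of "cut H (- x) - ?G n (- x)"]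
        by simp
      finally show "ennreal ((norm (cadj (cut H x) - cut H (- x)))\<^sup>2) \<le>
          r * ennreal ((mnorm (cut H x - ?G n x))\<^sup>2) + r * ennreal ((mnorm (cut H (- x) - ?G n (- x)))\<^sup>2)"
        unfolding r_def by (simp flip: ennreal_mult ennreal_plus add: ennreal_leI)
    qed
    also have "\<dots> = r * ?d n + r * (\<integral>\<^sup>+x. ennreal ((mnorm (cut H (- x) - ?G n (- x)))\<^sup>2) \<partial>lebesgue)"
      by (subst nn_integral_add) (auto simp: nn_integral_cmult)
    also have "(\<integral>\<^sup>+x. ennreal ((mnorm (cut H (- x) - ?G n (- x)))\<^sup>2) \<partial>lebesgue) = ?d n"
      by (subst nn_integral_real_affine_lebesgue[where c="-1" and t=0 and f="\<lambda>x. ennreal ((mnorm (cut H x - ?G n x))\<^sup>2)"]) auto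
    finally show ?thesis by (simp add: mult_2)
  qed
  moreover have "(\<lambda>n. 2 * (r * ?d n)) \<longlonglongrightarrow> 2 * (r * 0)"
    by (intro ennreal_tendsto_cmult lim) (auto simp: r_def)
  ultimately have "?R \<le> 0"
    by (intro LIMSEQ_le_const[of _ _ ?R]) auto
  then have "AE x in lebesgue. ennreal ((norm (cadj (cut H x) - cut H (- x)))\<^sup>2) = 0"
    by (subst (asm) le_zero_eq, subst (asm) nn_integral_0_iff_AE) auto
  then show ?thesis
    by eventually_elim (auto simp: cut_def ennreal_eq_0_iff)
qed

lemma mnorm_minus_commute: "mnorm (A - B) = mnorm (B - A)"
proof -
  have "(\<lambda>v. (A - B) *v v) = (\<lambda>v. - ((B - A) *v v))"
    by (simp add: fun_eq_iff matrix_vector_mult_diff_rdistrib)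
  then show ?thesis unfolding mnorm_def by (simp add: onorm_neg)
qed

text \<open>For each fixed window, the nonnegative quadratic terms of its nodes sum to at most
  \<open>e * L\<close>, with e the uniform distance between the two convolutions. Every node lies in
  all large windows, so each term is below every positive bound.\<close>

lemma accelerant_equation_trivial:
  fixes alpha :: "int \<Rightarrow> complex^'r^'r" and f :: "real \<Rightarrow> complex^'r"
  assumes fin: "\<And>k. finite (nodes lam k)" and pos: "\<And>j. mpos (alpha j)" and A3: "condA3 lam alpha"
    and H: "cut H \<in> borel_measurable lebesgue"
    and lim: "(\<lambda>n. \<integral>\<^sup>+x. ennreal ((mnorm (cut H x - cut (Hpart lam alpha n) x))\<^sup>2) \<partial>lebesgue) \<longlonglongrightarrow> 0"
    and a: "a \<in> {0..1}" and f: "sq_int {0<..<1} norm f"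
    and eqn: "AE x in lebesgue. x \<in> {0<..<1} \<longrightarrow> f x + (\<integral>t\<in>{0..a}. H (x - t) *v f t \<partial>lebesgue) = 0"
  shows "AE x in lebesgue. x \<in> {0<..<1} \<longrightarrow> f x = 0"
proof -
  let ?F = "Hpart lam alpha"
  let ?G = "\<lambda>n. cut (?F n)"
  let ?d = "\<lambda>n. \<integral>\<^sup>+x. ennreal ((mnorm (cut H x - ?G n x))\<^sup>2) \<partial>lebesgue"
  \<comment> \<open>Support inside (0,1) keeps x - t in (-1,1) for x in (0,1), where
    \<open>cut H\<close> and H agree.\<close>
  define u where "u t = indicator {0<..<a} t *\<^sub>R f t" for t
  define T where "T x = (\<integral>t. cut H (x - t) *v u t \<partial>lebesgue)" for x
  define b where "b k = fourier u (pi * real_of_int k)" for k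
  define U where "U j = fourier u (lam j)" for j
  define Tn where "Tn n x = (\<Sum>k\<in>{1 - int n..int n}.
      (\<Sum>j\<in>nodes lam k. cis (2 * lam j * x) *s (alpha j *v U j)) - cis (2 * (pi * real_of_int k) * x) *s b k)"
    for n x
  have usupp: "u t = 0" if "t \<notin> {0<..<1}" for t
    using that a by (auto simp: u_def indicator_def)
  have f_meas: "(\<lambda>t. indicator {0<..<1} t *\<^sub>R f t) \<in> borel_measurable lebesgue"
    using f by (simp add: sq_int_def set_borel_measurable_def)
  have u_eq: "u t = indicator {0<..<a} t *\<^sub>R (indicator {0<..<1} t *\<^sub>R f t)" for t
    using a by (auto simp: u_def indicator_def)
  have u_meas[measurable]: "u \<in> borel_measurable lebesgue"
    unfolding u_eq[abs_def] by (intro borel_measurable_scaleR f_meas borel_measurable_indicator) auto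
  have "(\<integral>\<^sup>+t. ennreal ((norm (u t))\<^sup>2) \<partial>lebesgue) \<le> (\<integral>\<^sup>+t\<in>{0<..<1}. ennreal ((norm (f t))\<^sup>2) \<partial>lebesgue)"
    using a by (intro nn_integral_mono) (auto simp: u_def indicator_def)
  also have "\<dots> < \<infinity>" using f by (simp add: sq_int_def)
  finally have ufin: "(\<integral>\<^sup>+t. ennreal ((norm (u t))\<^sup>2) \<partial>lebesgue) < \<infinity>" .
  then have u2: "integrable lebesgue (\<lambda>t. (norm (u t))\<^sup>2)"
    by (simp add: integrable_iff_bounded)
  define \<Phi> where "\<Phi> = (\<integral>t. (norm (u t))\<^sup>2 \<partial>lebesgue)"
  have \<Phi>: "(\<integral>\<^sup>+t. ennreal ((norm (u t))\<^sup>2) \<partial>lebesgue) = ennreal \<Phi>" "0 \<le> \<Phi>"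
    using nn_integral_eq_integral[OF u2] by (simp_all add: \<Phi>_def)
  \<comment> \<open>On the bounded support |u| \<le> 1 + |u|^2, which gives L_1 from L_2.\<close>
  have u_int: "integrable lebesgue u"
  proof (rule Bochner_Integration.integrable_bound)
    show "integrable lebesgue (\<lambda>t. indicator {0..1} t + (norm (u t))\<^sup>2)"
      by (intro Bochner_Integration.integrable_add u2) (auto simp: integrable_indicator_iff)
    show "AE t in lebesgue. norm (u t) \<le> norm (indicator {0..1} t + (norm (u t))\<^sup>2)"
    proof (rule AE_I2)
      fix t
      have "2 * norm (u t) \<le> 1 + (norm (u t))\<^sup>2"
        using sum_squares_bound[of "norm (u t)" 1] by simp
      then have "norm (u t) \<le> 1 + (norm (u t))\<^sup>2"
        by (smt (verit) norm_ge_zero)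
      then show "norm (u t) \<le> norm (indicator {0..1} t + (norm (u t))\<^sup>2)"
        using usupp[of t] by (cases "t \<in> {0..1}") auto
    qed
  qed simp
  define L where "L = (\<integral>t. norm (u t) \<partial>lebesgue)"
  have L0: "0 \<le> L" by (simp add: L_def)
  have contF: "continuous_on S (?F n)" for S n
    unfolding Hpart_eq_sum_block[OF fin] by (intro continuous_intros continuous_block)
  have G_meas: "?G n \<in> borel_measurable lebesgue" for n
    unfolding cut_def
    by (intro borel_measurable_scaleR borel_measurable_indicator continuous_imp_borel_measurable_lebesgue contF) auto
  have Gconv: "?G n (x - t) *v u t = (\<Sum>k\<in>{1 - int n..int n}. block lam alpha k (x - t) *v u t)"
    if x: "x \<in> {0<..<1}" for n x t
  proof (cases "t \<in> {0<..<1}")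
    case True
    then have "x - t \<in> {-1<..<1}" using x by auto
    then show ?thesis
      by (simp add: cut_def Hpart_eq_sum_block[OF fin] matrix_vector_mult_sum_left)
  qed (simp add: usupp)
  have Gint: "integrable lebesgue (\<lambda>t. ?G n (x - t) *v u t)" if "x \<in> {0<..<1}" for n x
    unfolding Gconv[OF that] by (intro Bochner_Integration.integrable_sum integrable_block_convolution fin u_int)
  have Gval: "(\<integral>t. ?G n (x - t) *v u t \<partial>lebesgue) = Tn n x" if "x \<in> {0<..<1}" for n x
    unfolding Gconv[OF that] Tn_def b_def U_def
    by (subst Bochner_Integration.integral_sum)
       (auto intro!: integrable_block_convolution fin u_int simp: integral_block_convolution[OF fin u_int])
  \<comment> \<open>Dividing by \<open>\<Phi> + 1\<close> avoids a zero denominator and makes the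
    product with \<open>\<Phi>\<close> at most e^2. The same n serves every x in (0,1).\<close>
  have bound: "norm (T x - Tn n x) \<le> e"
    if x: "x \<in> {0<..<1}" and e: "0 < e" and d: "?d n \<le> ennreal (e\<^sup>2 / (\<Phi> + 1))" for n x e
  proof -
    let ?D = "\<lambda>x. cut H x - ?G n x"
    have D: "?D \<in> borel_measurable lebesgue" using H G_meas by simp
    have "(\<integral>\<^sup>+t. ennreal (norm (?D (x - t) *v u t)) \<partial>lebesgue)\<^sup>2 \<le> ?d n * ennreal \<Phi>"
      using convolution_bound(2)[OF D u_meas, of x] by (simp add: \<Phi>)
    also have "\<dots> \<le> ennreal (e\<^sup>2 / (\<Phi> + 1)) * ennreal \<Phi>"
      by (intro mult_right_mono d) auto
    also have "\<dots> = ennreal (e\<^sup>2 * (\<Phi> / (\<Phi> + 1)))"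
      using \<Phi>(2) by (simp flip: ennreal_mult)
    also have "\<dots> \<le> ennreal (e\<^sup>2 * 1)"
      using \<Phi>(2) by (intro ennreal_leI mult_left_mono) auto
    finally have sq: "(\<integral>\<^sup>+t. ennreal (norm (?D (x - t) *v u t)) \<partial>lebesgue)\<^sup>2 \<le> (ennreal e)\<^sup>2"
      using e by (simp add: ennreal_power)
    have le: "(\<integral>\<^sup>+t. ennreal (norm (?D (x - t) *v u t)) \<partial>lebesgue) \<le> ennreal e"
    proof (cases "\<integral>\<^sup>+t. ennreal (norm (?D (x - t) *v u t)) \<partial>lebesgue")
      case (real r)
      with sq e show ?thesis by (auto simp: ennreal_power intro: power2_le_imp_le)
    next
      case top
      with sq e show ?thesis by (simp add: ennreal_power top_unique)
    qed
    have Dint: "integrable lebesgue (\<lambda>t. ?D (x - t) *v u t)"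
      unfolding integrable_iff_bounded using convolution_bound(1)[OF D u_meas, of x] le
      by (auto intro: le_less_trans)
    \<comment> \<open>Integrability of the convolution with H is read off from that of the
      difference plus the explicit partial sum.\<close>
    have "integrable lebesgue (\<lambda>t. ?D (x - t) *v u t + ?G n (x - t) *v u t)"
      by (intro Bochner_Integration.integrable_add Dint Gint x)
    then have Hint: "integrable lebesgue (\<lambda>t. cut H (x - t) *v u t)"
      by (simp add: matrix_vector_mult_diff_rdistrib)
    have "T x - Tn n x = (\<integral>t. ?D (x - t) *v u t \<partial>lebesgue)"
      unfolding T_def Gval[OF x, symmetric] matrix_vector_mult_diff_rdistrib
      by (rule Bochner_Integration.integral_diff[symmetric]) (intro Hint Gint x)+
    also have "ennreal (norm \<dots>) \<le> (\<integral>\<^sup>+t. ennreal (norm (?D (x - t) *v u t)) \<partial>lebesgue)"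
      by (rule integral_norm_bound_ennreal[OF Dint])
    also note le
    finally show ?thesis using e by simp
  qed
  have Teq: "(\<integral>t\<in>{0..a}. H (x - t) *v f t \<partial>lebesgue) = T x" if x: "x \<in> {0<..<1}" for x
  proof -
    have m: "(\<lambda>t. cut H (x - t) *v u t) \<in> borel_measurable lebesgue"
      by (rule convolution_bound(1)[OF H u_meas])
    \<comment> \<open>The equation integrates over the closed interval, u lives on the open one;
      only two points are at stake.\<close>
    have "AE t in lebesgue. t \<noteq> 0 \<and> t \<noteq> a"
      by (intro AE_conjI AE_completion AE_lborel_singleton)
    then have ae: "AE t in lebesgue. cut H (x - t) *v u t = indicator {0..a} t *\<^sub>R (H (x - t) *v f t)"
    proof eventually_elim
      case (elim t)
      show ?case
      proof (cases "t \<in> {0<..<a}")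
        case True
        then have "x - t \<in> {-1<..<1}" using x a by auto
        with True show ?thesis by (simp add: cut_def u_def)
      next
        case False
        with elim have "t \<notin> {0..a}" by auto
        with False show ?thesis by (simp add: u_def)
      qed
    qed
    show ?thesis
      unfolding set_lebesgue_integral_def T_def
      by (rule integral_cong_AE[OF borel_measurable_AE[OF m ae] m]) (use ae in \<open>auto elim: eventually_mono\<close>)
  qed
  have eqn': "AE x in lebesgue. x \<in> {0<..<1} \<longrightarrow> f x + T x = 0"
    using eqn by eventually_elim (simp add: Teq)
  \<comment> \<open>On (0,a) the equation says u = -T, so |u|^2 plus the pairing of
    \<open>Tn n x\<close> with u is the pairing of Tn - T with u, at most e |u|; elsewhere u
    vanishes. Integration gives \<open>e * L\<close>.\<close>
  have energy: "(\<Sum>k\<in>{1 - int n..int n}. \<Sum>j\<in>nodes lam k. inner (U j) (alpha j *v U j)) \<le> e * L"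
    if e: "0 < e" and d: "?d n \<le> ennreal (e\<^sup>2 / (\<Phi> + 1))" for n e
  proof -
    let ?K = "{1 - int n..int n}"
    have iu: "inner (Tn n x) (u x) = (\<Sum>k\<in>?K. (\<Sum>j\<in>nodes lam k. inner (cis (2 * lam j * x) *s (alpha j *v U j)) (u x))
        - inner (cis (2 * (pi * real_of_int k) * x) *s b k) (u x))" for x
      by (simp add: Tn_def inner_sum_left inner_diff_left)
    have i1: "integrable lebesgue (\<lambda>x. \<Sum>j\<in>nodes lam k. inner (cis (2 * lam j * x) *s (alpha j *v U j)) (u x))" for k
      by (intro Bochner_Integration.integrable_sum integrable_inner_cis u_int)
    have iT: "integrable lebesgue (\<lambda>x. inner (Tn n x) (u x))"
      unfolding iu
      by (intro Bochner_Integration.integrable_sum Bochner_Integration.integrable_diff i1 integrable_inner_cis u_int)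
    have "(\<integral>x. inner (Tn n x) (u x) \<partial>lebesgue) = (\<Sum>k\<in>?K. (\<integral>x. (\<Sum>j\<in>nodes lam k. inner (cis (2 * lam j * x) *s (alpha j *v U j)) (u x))
        - inner (cis (2 * (pi * real_of_int k) * x) *s b k) (u x) \<partial>lebesgue))"
      unfolding iu
      by (intro Bochner_Integration.integral_sum Bochner_Integration.integrable_diff i1 integrable_inner_cis u_int)
    also have "\<dots> = (\<Sum>k\<in>?K. (\<Sum>j\<in>nodes lam k. inner (alpha j *v U j) (U j)) - inner (b k) (b k))"
    proof (rule sum.cong[OF refl])
      fix k
      show "(\<integral>x. (\<Sum>j\<in>nodes lam k. inner (cis (2 * lam j * x) *s (alpha j *v U j)) (u x))
        - inner (cis (2 * (pi * real_of_int k) * x) *s b k) (u x) \<partial>lebesgue)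
        = (\<Sum>j\<in>nodes lam k. inner (alpha j *v U j) (U j)) - inner (b k) (b k)"
        by (subst Bochner_Integration.integral_diff[OF i1 integrable_inner_cis[OF u_int]],
            subst Bochner_Integration.integral_sum[OF integrable_inner_cis[OF u_int]])
           (simp add: integral_inner_cis[OF u_int] b_def U_def)
    qed
    finally have val: "(\<integral>x. inner (Tn n x) (u x) \<partial>lebesgue) =
       (\<Sum>k\<in>?K. \<Sum>j\<in>nodes lam k. inner (U j) (alpha j *v U j)) - (\<Sum>k\<in>?K. (norm (b k))\<^sup>2)"
      by (simp add: sum_subtractf power2_norm_eq_inner inner_commute)
    have "\<Phi> + (\<integral>x. inner (Tn n x) (u x) \<partial>lebesgue) = (\<integral>x. (norm (u x))\<^sup>2 + inner (Tn n x) (u x) \<partial>lebesgue)"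
      unfolding \<Phi>_def using u2 iT by simp
    also have "\<dots> \<le> (\<integral>x. e * norm (u x) \<partial>lebesgue)"
    proof (rule integral_mono_AE)
      show "integrable lebesgue (\<lambda>x. (norm (u x))\<^sup>2 + inner (Tn n x) (u x))" using u2 iT by simp
      show "integrable lebesgue (\<lambda>x. e * norm (u x))" using u_int by simp
      show "AE x in lebesgue. (norm (u x))\<^sup>2 + inner (Tn n x) (u x) \<le> e * norm (u x)"
        using eqn'
      proof eventually_elim
        case (elim x)
        show ?case
        proof (cases "x \<in> {0<..<a}")
          case True
          then have x: "x \<in> {0<..<1}" using a by auto
          have "u x = f x" using True by (simp add: u_def)
          then have ux: "u x = - T x" using elim x by (simp add: eq_neg_iff_add_eq_0)
          have "(norm (u x))\<^sup>2 + inner (Tn n x) (u x) = inner (u x + Tn n x) (u x)"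
            by (simp add: power2_norm_eq_inner inner_add_left)
          also have "\<dots> \<le> norm (u x + Tn n x) * norm (u x)" by (rule norm_cauchy_schwarz)
          also have "\<dots> \<le> e * norm (u x)"
            using bound[OF x e d] unfolding ux
            by (intro mult_right_mono) (simp_all add: norm_minus_commute)
          finally show ?thesis .
        qed (simp add: u_def)
      qed
    qed
    also have "\<dots> = e * L" by (simp add: L_def)
    finally have "\<Phi> + (\<integral>x. inner (Tn n x) (u x) \<partial>lebesgue) \<le> e * L" .
    moreover have "(\<Sum>k\<in>?K. (norm (b k))\<^sup>2) \<le> \<Phi>"
      unfolding b_def \<Phi>_def by (rule bessel[OF u_int u2]) (use usupp in auto)
    ultimately show ?thesis using val by simp
  qed
  have "alpha j *v U j = 0" for j
  proof -
    obtain k where k: "j \<in> nodes lam k" using ex_Delta unfolding nodes_def by blast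
    have nonneg: "0 \<le> inner (U i) (alpha i *v U i)" for i by (rule mpos_inner_nonneg[OF pos])
    have "inner (U j) (alpha j *v U j) \<le> 0 + \<epsilon>" if \<epsilon>: "0 < \<epsilon>" for \<epsilon>
    proof -
      \<comment> \<open>Chosen so that \<open>e * L\<close> is at most \<epsilon>, also when L =
        0.\<close>
      define e where "e = \<epsilon> / (L + 1)"
      have e: "0 < e" using \<epsilon> L0 by (simp add: e_def)
      have "0 < e\<^sup>2 / (\<Phi> + 1)" using e \<Phi>(2) by simp
      then have "\<forall>\<^sub>F n in sequentially. ?d n < ennreal (e\<^sup>2 / (\<Phi> + 1))"
        by (intro order_tendstoD(2)[OF lim]) simp
      \<comment> \<open>The extra 1 places k in \<open>{1 - int n..int n}\<close> also for negative
        k.\<close>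
      moreover have "\<forall>\<^sub>F n in sequentially. nat \<bar>k\<bar> + 1 \<le> n" by (rule eventually_ge_at_top)
      ultimately have "\<forall>\<^sub>F n in sequentially. ?d n \<le> ennreal (e\<^sup>2 / (\<Phi> + 1)) \<and> nat \<bar>k\<bar> + 1 \<le> n"
        by eventually_elim auto
      then obtain n where n: "?d n \<le> ennreal (e\<^sup>2 / (\<Phi> + 1))" "nat \<bar>k\<bar> + 1 \<le> n"
        by (auto simp: eventually_sequentially)
      have "inner (U j) (alpha j *v U j) \<le> (\<Sum>i\<in>nodes lam k. inner (U i) (alpha i *v U i))"
        by (rule member_le_sum[OF k]) (use nonneg fin in auto)
      also have "\<dots> \<le> (\<Sum>k\<in>{1 - int n..int n}. \<Sum>i\<in>nodes lam k. inner (U i) (alpha i *v U i))"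
        using n(2) by (intro member_le_sum sum_nonneg nonneg) auto
      also have "\<dots> \<le> e * L" by (rule energy[OF e n(1)])
      also have "\<dots> \<le> \<epsilon>" using L0 \<epsilon> by (simp add: e_def field_simps)
      finally show ?thesis by simp
    qed
    then have "inner (U j) (alpha j *v U j) \<le> 0" by (rule field_le_epsilon)
    with nonneg[of j] show ?thesis by (intro mpos_inner_eq_0[OF pos]) simp
  qed
  then have "AE t in lebesgue. u t = 0"
    using complete_orthogonal_imp_zero[OF A3 pos u_int u2 usupp] unfolding U_def by blast
  \<comment> \<open>T depends only on the part of f on (0,a), yet the equation holds on all of
    (0,1); so f = -T = 0 beyond a as well.\<close>
  then have "T x = 0" for x
    unfolding T_def by (intro integral_eq_zero_AE) (auto elim: eventually_mono)
  with eqn' show ?thesis by simp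
qed

theorem theorem1p3:
  fixes lam :: "int \<Rightarrow> real" and alpha :: "int \<Rightarrow> complex^'r^'r"
  assumes "strict_mono lam" and "lam 0 \<le> 0" and "0 < lam 1"
    and "\<And>j. alpha j \<noteq> 0 \<and> mpos (alpha j)"
    and "condA1 lam alpha"
  shows "(\<exists>H. L2_tendsto {-1<..<1} mnorm (Hpart lam alpha) H) \<and>
         (condA3 lam alpha \<longrightarrow>
            (\<forall>H. L2_tendsto {-1<..<1} mnorm (Hpart lam alpha) H \<longrightarrow> accelerant_s H))"
proof (intro conjI impI allI)
  have pos: "mpos (alpha j)" for j using assms(4) by blast
  have fin: "finite (nodes lam k)" for k
    using assms(5) by (simp add: condA1_def nodes_def)
  show "\<exists>H. L2_tendsto {-1<..<1} mnorm (Hpart lam alpha) H"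
    by (rule L2_tendsto_Hpart[OF assms(5) pos])
  fix H assume A3: "condA3 lam alpha" and H: "L2_tendsto {-1<..<1} mnorm (Hpart lam alpha) H"
  then have sq: "sq_int {-1<..<1} mnorm H" by (simp add: L2_tendsto_def)
  then have meas: "cut H \<in> borel_measurable lebesgue"
    by (simp add: sq_int_def set_borel_measurable_def cut_def[abs_def])
  \<comment> \<open>Outside (-1,1) both zero extensions vanish, so the whole-line integral equals
    the one over (-1,1).\<close>
  have "mnorm (0::complex^'r^'r) = 0"
    using mnorm_le_norm[of "0::complex^'r^'r"] mnorm_nonneg[of "0::complex^'r^'r"] by simp
  then have "ennreal ((mnorm (Hpart lam alpha n x - H x))\<^sup>2) * indicator {-1<..<1} x =
      ennreal ((mnorm (cut H x - cut (Hpart lam alpha n) x))\<^sup>2)" for n x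
    by (simp add: cut_def indicator_def mnorm_minus_commute)
  with H have lim: "(\<lambda>n. \<integral>\<^sup>+x. ennreal ((mnorm (cut H x - cut (Hpart lam alpha n) x))\<^sup>2) \<partial>lebesgue) \<longlonglongrightarrow> 0"
    by (simp add: L2_tendsto_def)
  have "cut (Hpart lam alpha n) \<in> borel_measurable lebesgue" for n
    unfolding cut_def Hpart_eq_sum_block[OF fin]
    by (intro borel_measurable_scaleR borel_measurable_indicator continuous_imp_borel_measurable_lebesgue
        continuous_intros continuous_block) auto
  then have "AE x in lebesgue. x \<in> {-1<..<1} \<longrightarrow> cadj (H x) = H (- x)"
    by (intro L2_limit_symmetric[OF fin pos meas _ lim])
  moreover have "accelerant H"
    unfolding accelerant_def
    using sq accelerant_equation_trivial[OF fin pos A3 meas lim] by blast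
  ultimately show "accelerant_s H" by (simp add: accelerant_s_def)
qed

end
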